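(* Every nice graph $G$ admits a p-proper $3$-labelling. That is, if $G$ is a graph with no connected component isomorphic to $K_2$, then there exists a function $\ell : E(G) \to \{1,2,3\}$ such that $\rho_\ell(u) \neq \rho_\ell(v)$ for every edge $uv \in E(G)$, where $\rho_\ell(v) = \prod_{w \in N(v)} \ell(vw)$ for every vertex $v$.
   Context: Graphs are finite, simple and undirected. A graph is nice if it has no connected component isomorphic to $K_2$ (the complete graph on two vertices). A $k$-labelling of $G$ is a function $\ell : E(G) \to \{1,\dots,k\}$. For a vertex $v$, $\rho_\ell(v)$ is the product of the labels of the edges incident to $v$ (the empty product being $1$). The labelling $\ell$ is p-proper if $\rho_\ell(u) \ne \rho_\ell(v)$ for every edge $uv$ of $G$. *)

theory Defs
  imports "Graph_Theory.Kuratowski"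
begin

text \<open>
  Following the \<^theory>\<open>Graph_Theory.Digraph\<close> library, a finite simple undirected graph is a
  symmetric digraph satisfying the locale predicate \<^const>\<open>graph\<close>: finite, loop-free, and
  without parallel arcs. An undirected edge \<open>uv\<close> is thus represented by two opposite arcs, so
  edges are recovered here as unordered pairs, and a labelling assigns one label to each of them.
\<close>

definition edges :: "('a, 'b) pre_digraph \<Rightarrow> 'a set set" where
  "edges G = {{u, v} | u v. u \<rightarrow>\<^bsub>G\<^esub> v}"

definition neighbours :: "('a, 'b) pre_digraph \<Rightarrow> 'a \<Rightarrow> 'a set" where
  "neighbours G v = {w. {v, w} \<in> edges G}"

definition graph_component :: "('a, 'b) pre_digraph \<Rightarrow> ('a, 'b) pre_digraph \<Rightarrow> bool" where
  "graph_component G H \<longleftrightarrow> pre_digraph.max_subgraph G Digraph_Component.connected H"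

text \<open>
  The library predicate \<^term>\<open>complete_digraph n H\<close> says that \<open>H\<close> is a complete graph on \<open>n\<close>
  vertices, i.e. a copy of \<open>K\<^sub>n\<close>.
\<close>

definition nice :: "('a, 'b) pre_digraph \<Rightarrow> bool" where
  "nice G \<longleftrightarrow> \<not> (\<exists>H. graph_component G H \<and> complete_digraph 2 H)"

text \<open>Values of \<open>l\<close> outside \<open>edges G\<close> are unconstrained; \<open>vertex_prod\<close> never consults them.\<close>

definition labelling :: "nat \<Rightarrow> ('a, 'b) pre_digraph \<Rightarrow> ('a set \<Rightarrow> nat) \<Rightarrow> bool" where
  "labelling k G l \<longleftrightarrow> (\<forall>e \<in> edges G. l e \<in> {1..k})"

definition vertex_prod :: "('a, 'b) pre_digraph \<Rightarrow> ('a set \<Rightarrow> nat) \<Rightarrow> 'a \<Rightarrow> nat" where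
  "vertex_prod G l v = (\<Prod>w \<in> neighbours G v. l {v, w})"

definition p_proper :: "('a, 'b) pre_digraph \<Rightarrow> ('a set \<Rightarrow> nat) \<Rightarrow> bool" where
  "p_proper G l \<longleftrightarrow> (\<forall>u v. {u, v} \<in> edges G \<longrightarrow> vertex_prod G l u \<noteq> vertex_prod G l v)"

lemma (in graph) vertex_prod_incident_edges:
  "vertex_prod G l v = (\<Prod>e \<in> {e \<in> edges G. v \<in> e}. l e)"
proof -
  have "{e \<in> edges G. v \<in> e} = (\<lambda>w. {v, w}) ` neighbours G v"
    by (auto simp: edges_def neighbours_def image_iff insert_commute)
  moreover have "inj_on (\<lambda>w. {v, w}) (neighbours G v)"
    by (auto simp: inj_on_def doubleton_eq_iff)
  ultimately show ?thesis
    by (simp add: vertex_prod_def prod.reindex)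
qed

end

theory Submission
  imports Defs
begin

text \<open>
  Only the labels 2 and 3 matter: two vertices have different products iff they differ in the pair
  (number of incident 2s, number of incident 3s). Take a proper colouring with colours
  \<open>1, 2, \<dots>\<close> and minimal colour sum, so that every vertex of colour \<open>i\<close> has neighbours of all smaller
  colours. Going down from the largest colour, each vertex of colour \<open>i \<ge> 3\<close> labels its edges to
  smaller colours, using 1 or 2 towards odd colours and 1 or 3 towards even colours. Then later choices
  never affect its number of 3s (\<open>i\<close> odd) or of 2s (\<open>i\<close> even), which is made \<open>i div 2\<close>; the other
  number is made positive with a parity depending on that of \<open>i\<close>. This separates all vertices of
  colour at least 3 from each other, and colour 1 receives no 3, colour 2 no 2. An isolated edge of
  the bipartite graph spanned by the colours 1 and 2 has, as the graph is nice, a neighbour of larger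
  colour, and the freedom of swapping its two colours ensures that one of its ends receives a label
  different from 1. The other components of this bipartite graph are labelled such that each
  vertex gets a pair \<open>(p, 0)\<close>, \<open>(0, q)\<close> or \<open>(1, q)\<close> with \<open>q\<close> even, and these pairs do not occur at
  larger colours; the basic tool is to prescribe the parities of the 3-degrees.
\<close>

section \<open>Edge sets with prescribed degree parities\<close>

definition edge_degree :: "'a set set \<Rightarrow> 'a \<Rightarrow> nat" where
  "edge_degree S v = card {e \<in> S. v \<in> e}"

text \<open>A singleton in \<open>E\<close> would be an edge \<open>{u, u}\<close> whose toggling
  changes one parity only; \<open>u \<noteq> v\<close> excludes it.\<close>

definition edge_rel :: "'a set set \<Rightarrow> ('a \<times> 'a) set" where
  "edge_rel E = {(u, v). {u, v} \<in> E \<and> u \<noteq> v}"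

lemma edge_degree_empty [simp]: "edge_degree {} v = 0"
  by (simp add: edge_degree_def)

lemma edge_degree_eq_0: "(\<And>e. e \<in> S \<Longrightarrow> v \<notin> e) \<Longrightarrow> edge_degree S v = 0"
  unfolding edge_degree_def by (metis (mono_tags, lifting) card.empty empty_Collect_eq)

lemma edge_degree_ge_1: "finite S \<Longrightarrow> e \<in> S \<Longrightarrow> v \<in> e \<Longrightarrow> edge_degree S v \<ge> 1"
  by (auto simp: edge_degree_def Suc_le_eq card_gt_0_iff)

lemma edge_degree_singleton: "edge_degree {e} v = (if v \<in> e then 1 else 0)"
proof -
  have "{f \<in> {e}. v \<in> f} = (if v \<in> e then {e} else {})" by auto
  then show ?thesis by (simp add: edge_degree_def)
qed

lemma edge_degree_Un:
  assumes "finite S" "finite T" "S \<inter> T = {}"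
  shows "edge_degree (S \<union> T) v = edge_degree S v + edge_degree T v"
proof -
  have "{e \<in> S \<union> T. v \<in> e} = {e \<in> S. v \<in> e} \<union> {e \<in> T. v \<in> e}" by auto
  moreover have "{e \<in> S. v \<in> e} \<inter> {e \<in> T. v \<in> e} = {}" using assms by auto
  ultimately show ?thesis
    using assms by (simp add: edge_degree_def card_Un_disjoint)
qed

lemma edge_degree_star:
  assumes "x \<notin> M"
  shows "edge_degree ((\<lambda>y. {x, y}) ` M) v = (if v = x then card M else if v \<in> M then 1 else 0)"
proof -
  have inj: "inj_on (\<lambda>y. {x, y}) M" by (auto simp: inj_on_def doubleton_eq_iff)
  consider "v = x" | "v \<noteq> x" "v \<in> M" | "v \<noteq> x" "v \<notin> M" by blast
  then show ?thesis
  proof cases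
    case 1
    then have "{e \<in> (\<lambda>y. {x, y}) ` M. v \<in> e} = (\<lambda>y. {x, y}) ` M" by auto
    then show ?thesis using 1 inj by (simp add: edge_degree_def card_image)
  next
    case 2
    then have "{e \<in> (\<lambda>y. {x, y}) ` M. v \<in> e} = {{x, v}}" by auto
    then show ?thesis using 2 by (simp add: edge_degree_def)
  next
    case 3
    then show ?thesis by (auto intro: edge_degree_eq_0)
  qed
qed

text \<open>As \<open>p\<close> leads out of \<open>M\<close>, each \<open>y\<close> in
  \<open>M\<close> lies only on its own edge. Since \<open>p\<close> may fail to be injective,
  degrees on its image are left open.\<close>

lemma edge_degree_pick:
  assumes "\<And>y. y \<in> M \<Longrightarrow> p y \<notin> M"
  shows "y \<in> M \<Longrightarrow> edge_degree ((\<lambda>y. {p y, y}) ` M) y = 1"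
    and "v \<notin> M \<Longrightarrow> v \<notin> p ` M \<Longrightarrow> edge_degree ((\<lambda>y. {p y, y}) ` M) v = 0"
proof -
  show "edge_degree ((\<lambda>y. {p y, y}) ` M) y = 1" if "y \<in> M"
  proof -
    have "{e \<in> (\<lambda>y. {p y, y}) ` M. y \<in> e} = {{p y, y}}"
      using that assms by auto
    then show ?thesis by (simp add: edge_degree_def)
  qed
  show "edge_degree ((\<lambda>y. {p y, y}) ` M) v = 0" if "v \<notin> M" "v \<notin> p ` M"
    using that by (intro edge_degree_eq_0) auto
qed

lemma card_sym_diff_parity:
  assumes "finite A" "finite B"
  shows "odd (card (sym_diff A B)) \<longleftrightarrow> odd (card A) \<noteq> odd (card B)"
proof -
  have "card (sym_diff A B) = card (A - B) + card (B - A)"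
    using assms by (subst card_Un_disjoint) auto
  moreover have "card A = card (A - B) + card (A \<inter> B)"
    using card_Int_Diff[OF assms(1), of B] by (simp add: add.commute)
  moreover have "card B = card (B - A) + card (A \<inter> B)"
    using card_Int_Diff[OF assms(2), of A] by (simp add: add.commute Int_commute)
  ultimately show ?thesis by auto
qed

lemma edge_degree_sym_diff_parity:
  assumes "finite S" "finite T"
  shows "odd (edge_degree (sym_diff S T) v) \<longleftrightarrow> odd (edge_degree S v) \<noteq> odd (edge_degree T v)"
proof -
  have eq: "{e \<in> sym_diff S T. v \<in> e} = sym_diff {e \<in> S. v \<in> e} {e \<in> T. v \<in> e}" by auto
  then show ?thesis
    unfolding edge_degree_def using assms by (subst eq, subst card_sym_diff_parity) simp_all
qed

text \<open>Toggling the edges of a walk one by one moves its odd end along; the symmetric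
  difference cancels edges that are passed twice.\<close>

lemma path_edge_parity:
  assumes "finite E" "(v, r) \<in> (edge_rel E)\<^sup>*"
  shows "\<exists>S \<subseteq> E. \<forall>x. odd (edge_degree S x) \<longleftrightarrow> (x = v) \<noteq> (x = r)"
  using assms(2)
proof (induction rule: converse_rtrancl_induct)
  case base
  show ?case by (intro exI[of _ "{}"]) auto
next
  case (step u v)
  then obtain S where S: "S \<subseteq> E" "\<And>x. odd (edge_degree S x) \<longleftrightarrow> (x = v) \<noteq> (x = r)" by blast
  have uv: "{u, v} \<in> E" "u \<noteq> v" using step by (auto simp: edge_rel_def)
  have "finite S" using S(1) assms(1) finite_subset by blast
  then have "odd (edge_degree (sym_diff S {{u, v}}) x) \<longleftrightarrow> (x = u) \<noteq> (x = r)" for x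
    using uv by (subst edge_degree_sym_diff_parity) (auto simp: S(2) edge_degree_singleton)
  then show ?case using S(1) uv by (intro exI[of _ "sym_diff S {{u, v}}"]) auto
qed

text \<open>Add up, modulo 2, a walk to \<open>R\<close> from each vertex of \<open>A - R\<close>.
  The vertices of \<open>R\<close> absorb the other ends, so nothing is claimed about them.\<close>

lemma prescribed_edge_parity:
  assumes "finite E" "finite A"
    and reach: "\<And>v. v \<in> A - R \<Longrightarrow> \<exists>r \<in> R. (v, r) \<in> (edge_rel E)\<^sup>*"
  shows "\<exists>S \<subseteq> E. \<forall>v. v \<notin> R \<longrightarrow> (odd (edge_degree S v) \<longleftrightarrow> v \<in> A)"
  using assms(2) reach
proof (induction A rule: finite_induct)
  case empty
  show ?case by (intro exI[of _ "{}"]) auto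
next
  case (insert u A)
  then obtain S where S: "S \<subseteq> E" "\<And>v. v \<notin> R \<Longrightarrow> odd (edge_degree S v) \<longleftrightarrow> v \<in> A" by blast
  show ?case
  proof (cases "u \<in> R")
    case True
    then show ?thesis using S by (intro exI[of _ S]) auto
  next
    case False
    then obtain r where r: "r \<in> R" "(u, r) \<in> (edge_rel E)\<^sup>*" using insert.prems by blast
    obtain T where T: "T \<subseteq> E" "\<And>x. odd (edge_degree T x) \<longleftrightarrow> (x = u) \<noteq> (x = r)"
      using path_edge_parity[OF assms(1) r(2)] by blast
    have "finite S" "finite T" using S T assms(1) finite_subset by blast+
    then have "odd (edge_degree (sym_diff S T) v) \<longleftrightarrow> v \<in> insert u A" if "v \<notin> R" for v
      using that S(2)[OF that] T(2) r(1) insert.hyps(2)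
      by (subst edge_degree_sym_diff_parity) auto
    then show ?thesis using S(1) T(1) by (intro exI[of _ "sym_diff S T"]) auto
  qed
qed

section \<open>Weighted bipartite graphs\<close>

text \<open>The pairs (number of 2s, number of 3s) that are never taken at a vertex of colour at least 3 by
  the labelling constructed from \<open>good_marks\<close> below.\<close>

definition admissible :: "nat \<Rightarrow> nat \<Rightarrow> bool" where
  "admissible p q \<longleftrightarrow> p = 0 \<or> q = 0 \<or> (p = 1 \<and> even q)"

text \<open>\<open>a\<close> and \<open>b\<close> count the labels 2 and 3 which a vertex already has on edges outside \<open>E\<close>.\<close>

locale weighted_bipartite =
  fixes X Y :: "'a set" and E :: "'a set set" and a b :: "'a \<Rightarrow> nat"
  assumes finite_X: "finite X" and finite_Y: "finite Y" and disjoint: "X \<inter> Y = {}"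
    and edgeE: "\<And>e. e \<in> E \<Longrightarrow> \<exists>x \<in> X. \<exists>y \<in> Y. e = {x, y}"
    and a_Y: "\<And>y. y \<in> Y \<Longrightarrow> a y = 0" and b_X: "\<And>x. x \<in> X \<Longrightarrow> b x = 0"
begin

text \<open>\<open>S\<^sub>2\<close> and \<open>S\<^sub>3\<close> are the edges of \<open>E\<close>
  to be labelled 2 and 3; the others get the label 1.\<close>

definition separating :: "'a set set \<Rightarrow> 'a set set \<Rightarrow> bool" where
  "separating S\<^sub>2 S\<^sub>3 \<longleftrightarrow> S\<^sub>2 \<subseteq> E \<and> S\<^sub>3 \<subseteq> E \<and> S\<^sub>2 \<inter> S\<^sub>3 = {} \<and>
    (\<forall>v \<in> X \<union> Y. admissible (a v + edge_degree S\<^sub>2 v) (b v + edge_degree S\<^sub>3 v)) \<and>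
    (\<forall>x \<in> X. \<forall>y \<in> Y. {x, y} \<in> E \<longrightarrow>
      (a x + edge_degree S\<^sub>2 x, b x + edge_degree S\<^sub>3 x) \<noteq> (a y + edge_degree S\<^sub>2 y, b y + edge_degree S\<^sub>3 y))"

lemma finite_E: "finite E"
proof -
  have "E \<subseteq> (\<lambda>(x, y). {x, y}) ` (X \<times> Y)"
  proof
    fix e assume "e \<in> E"
    then obtain x y where "x \<in> X" "y \<in> Y" "e = {x, y}" using edgeE by blast
    then show "e \<in> (\<lambda>(x, y). {x, y}) ` (X \<times> Y)" by force
  qed
  then show ?thesis by (rule finite_subset) (simp add: finite_X finite_Y)
qed

lemma edge_cases:
  assumes "{u, v} \<in> E"
  obtains "u \<in> X" "v \<in> Y" | "u \<in> Y" "v \<in> X"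
  using edgeE[OF assms] by (auto simp: doubleton_eq_iff)

text \<open>The neighbours of \<open>Z\<close> will absorb wrong parities: an edge set avoiding
  \<open>Z\<close> leaves their edges to \<open>Z\<close> free for later corrections.\<close>

definition boundary :: "'a set \<Rightarrow> 'a set" where
  "boundary Z = {y \<in> Y. \<exists>x \<in> Z. {x, y} \<in> E}"

definition avoiding :: "'a set \<Rightarrow> 'a set set" where
  "avoiding Z = {e \<in> E. e \<inter> Z = {}}"

text \<open>Cut the walk at its first vertex in \<open>Z\<close>. As \<open>Z \<subseteq> X\<close>,
  the vertex before it lies in \<open>Y\<close>, hence in the boundary, and no edge up to there
  meets \<open>Z\<close>.\<close>

lemma reach_boundary:
  assumes "Z \<subseteq> X" "(v, z) \<in> (edge_rel E)\<^sup>*" "z \<in> Z"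
  shows "v \<in> Z \<or> (\<exists>r \<in> boundary Z. (v, r) \<in> (edge_rel (avoiding Z))\<^sup>*)"
  using assms(2)
proof (induction rule: converse_rtrancl_induct)
  case base
  then show ?case using assms by simp
next
  case (step u v)
  then have uv: "{u, v} \<in> E" "u \<noteq> v" by (auto simp: edge_rel_def)
  consider "u \<in> Z" | "u \<notin> Z" "v \<in> Z" | "u \<notin> Z" "v \<notin> Z" by blast
  then show ?case
  proof cases
    case 2
    then have "v \<in> X" using assms(1) by blast
    then have "u \<in> Y" using uv disjoint by (auto elim: edge_cases)
    then have "u \<in> boundary Z" using 2 uv by (auto simp: boundary_def insert_commute)
    then show ?thesis by blast
  next
    case 3
    then have "(u, v) \<in> edge_rel (avoiding Z)" using uv by (auto simp: edge_rel_def avoiding_def)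
    then show ?thesis using step.IH 3 by (meson converse_rtrancl_into_rtrancl)
  qed auto
qed

end

locale connected_weighted_bipartite = weighted_bipartite +
  assumes connected: "\<And>u v. u \<in> X \<union> Y \<Longrightarrow> v \<in> X \<union> Y \<Longrightarrow> (u, v) \<in> (edge_rel E)\<^sup>*"
begin

text \<open>By connectedness every vertex outside \<open>Z\<close> walks to
  \<open>boundary Z\<close> without meeting \<open>Z\<close>, so the boundary can be the absorbing
  set in \<open>prescribed_edge_parity\<close>.\<close>

lemma parity_avoiding:
  assumes "Z \<subseteq> X" "Z \<noteq> {}" "A \<subseteq> X \<union> Y" "A \<inter> Z = {}"
  obtains S where "S \<subseteq> avoiding Z"
    and "\<And>v. v \<notin> boundary Z \<Longrightarrow> odd (edge_degree S v) \<longleftrightarrow> v \<in> A"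
proof -
  obtain z where z: "z \<in> Z" using assms by blast
  have "\<exists>r \<in> boundary Z. (v, r) \<in> (edge_rel (avoiding Z))\<^sup>*" if "v \<in> A" for v
    using reach_boundary[OF assms(1) connected z, of v] that assms z by blast
  moreover have "finite A" using assms(3) finite_X finite_Y finite_subset by blast
  moreover have "finite (avoiding Z)" using finite_E by (simp add: avoiding_def)
  ultimately show ?thesis
    using prescribed_edge_parity[of "avoiding Z" A "boundary Z"] that by blast
qed

text \<open>Toggling the two edges of a path \<open>y z y'\<close> would make two vertices of \<open>M\<close> odd at once, so a
  smallest possible \<open>M\<close> contains no two vertices with a common neighbour off \<open>Z\<close>.\<close>

lemma sparse_even_set:
  assumes Z: "Z \<subseteq> X" "Z \<noteq> {}"
  obtains S M where "S \<subseteq> avoiding Z" "M \<subseteq> boundary Z"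
    and "\<And>x. x \<in> X \<Longrightarrow> even (edge_degree S x)"
    and "\<And>y. y \<in> Y \<Longrightarrow> odd (b y + edge_degree S y) \<longleftrightarrow> y \<notin> M"
    and "\<And>y y' z. y \<in> M \<Longrightarrow> y' \<in> M \<Longrightarrow> {z, y} \<in> E \<Longrightarrow> {z, y'} \<in> E \<Longrightarrow> z \<notin> Z \<Longrightarrow> y = y'"
proof -
  define M where "M S = {y \<in> Y. even (b y + edge_degree S y)}" for S
  define P where "P S \<longleftrightarrow> S \<subseteq> avoiding Z \<and> (\<forall>x \<in> X. even (edge_degree S x)) \<and> M S \<subseteq> boundary Z" for S
  \<comment> \<open>Odd degree exactly where \<open>b\<close> is even makes the totals on
    \<open>Y\<close> odd, except possibly on the boundary.\<close>
  let ?A = "{y \<in> Y. even (b y)}"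
  have "?A \<inter> Z = {}" using Z disjoint by auto
  then obtain S\<^sub>0 where S0: "S\<^sub>0 \<subseteq> avoiding Z"
    "\<And>v. v \<notin> boundary Z \<Longrightarrow> odd (edge_degree S\<^sub>0 v) \<longleftrightarrow> v \<in> ?A"
    using parity_avoiding[OF Z, of ?A] by blast
  have "even (edge_degree S\<^sub>0 x)" if "x \<in> X" for x
    using S0(2)[of x] that disjoint by (auto simp: boundary_def)
  moreover have "M S\<^sub>0 \<subseteq> boundary Z"
    using S0(2) by (auto simp: M_def)
  ultimately have "P S\<^sub>0" using S0(1) by (auto simp: P_def)
  define S where "S = arg_min (\<lambda>S. card (M S)) P"
  have S: "P S" and min: "\<And>T. P T \<Longrightarrow> card (M S) \<le> card (M T)"
    using arg_min_nat_lemma[of P S\<^sub>0 "\<lambda>S. card (M S)"] \<open>P S\<^sub>0\<close> by (auto simp: S_def)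
  have fin: "finite S" using S finite_E by (auto simp: P_def avoiding_def intro: finite_subset)
  have "y = y'" if y: "y \<in> M S" "y' \<in> M S" "{z, y} \<in> E" "{z, y'} \<in> E" "z \<notin> Z" for y y' z
  proof (rule ccontr)
    assume ne: "y \<noteq> y'"
    have yY: "y \<in> Y" "y' \<in> Y" using y by (auto simp: M_def)
    then have z: "z \<in> X" using y disjoint by (auto elim: edge_cases)
    have zy: "z \<noteq> y" "z \<noteq> y'" using z yY disjoint by auto
    let ?D = "{{z, y}, {z, y'}}"
    define T where "T = sym_diff S ?D"
    have D: "odd (edge_degree ?D v) \<longleftrightarrow> v \<in> {y, y'}" for v
      using edge_degree_star[of z "{y, y'}" v] ne zy by auto
    have T: "odd (edge_degree T v) \<longleftrightarrow> odd (edge_degree S v) \<noteq> (v \<in> {y, y'})" for v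
      using edge_degree_sym_diff_parity[OF fin, of ?D v] D[of v] by (simp add: T_def)
    have MT: "M T = M S - {y, y'}"
      using T y(1,2) by (auto simp: M_def)
    have "?D \<subseteq> avoiding Z" using y yY z Z disjoint by (auto simp: avoiding_def)
    then have "T \<subseteq> avoiding Z" using S by (auto simp: P_def T_def)
    moreover have "even (edge_degree T x)" if "x \<in> X" for x
    proof -
      have "x \<notin> {y, y'}" using that yY disjoint by blast
      then show ?thesis using T[of x] S that by (simp add: P_def)
    qed
    moreover have "M T \<subseteq> boundary Z" using MT S by (auto simp: P_def)
    ultimately have "P T" by (simp add: P_def)
    moreover have "card (M T) < card (M S)"
      unfolding MT using y(1) finite_Y by (intro psubset_card_mono) (auto simp: M_def)
    ultimately show False using min by fastforce
  qed
  then show ?thesis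
    using S by (intro that[of S "M S"]) (simp_all add: P_def M_def)
qed

lemma edge_degree_avoiding: "S \<subseteq> avoiding Z \<Longrightarrow> x \<in> Z \<Longrightarrow> edge_degree S x = 0"
  by (intro edge_degree_eq_0) (auto simp: avoiding_def)

text \<open>\<open>S\<^sub>3\<close> makes the 3-degrees even on \<open>X\<close> and odd on \<open>Y - M\<close>. The vertices of \<open>M\<close> are told apart
  from their neighbours by labels 2: one each on \<open>M\<^sub>1\<close>, where the 3-degree is positive, and oddly
  many on \<open>F\<close>, where it vanishes and some neighbour off \<open>Z\<close> has 3-degree 0 as well. The remaining
  vertices of \<open>M\<close> keep the pair \<open>(0, 0)\<close>, which none of their neighbours has.\<close>

lemma separating_if_positive:
  assumes "x\<^sub>1 \<in> X" "a x\<^sub>1 > 0"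
  shows "\<exists>S\<^sub>2 S\<^sub>3. separating S\<^sub>2 S\<^sub>3"
proof -
  define Z where "Z = {x \<in> X. a x > 0}"
  have Z: "Z \<subseteq> X" "Z \<noteq> {}" using assms by (auto simp: Z_def)
  obtain S\<^sub>3 M where S3: "S\<^sub>3 \<subseteq> avoiding Z" and M: "M \<subseteq> boundary Z"
    and evenX: "\<And>x. x \<in> X \<Longrightarrow> even (edge_degree S\<^sub>3 x)"
    and oddY: "\<And>y. y \<in> Y \<Longrightarrow> odd (b y + edge_degree S\<^sub>3 y) \<longleftrightarrow> y \<notin> M"
    and sparse: "\<And>y y' z. y \<in> M \<Longrightarrow> y' \<in> M \<Longrightarrow> {z, y} \<in> E \<Longrightarrow> {z, y'} \<in> E \<Longrightarrow> z \<notin> Z \<Longrightarrow> y = y'"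
    using sparse_even_set[OF Z] by blast
  have finS3: "finite S\<^sub>3" using S3 finite_E by (auto simp: avoiding_def intro: finite_subset)
  have MY: "y \<in> Y" "y \<notin> X" if "y \<in> M" for y using that M disjoint by (auto simp: boundary_def)
  define M\<^sub>1 where "M\<^sub>1 = {y \<in> M. b y + edge_degree S\<^sub>3 y > 0}"
  define F where "F = {y \<in> M. b y + edge_degree S\<^sub>3 y = 0 \<and>
    (\<exists>z \<in> X - Z. {z, y} \<in> E \<and> edge_degree S\<^sub>3 z = 0)}"
  have MF: "M\<^sub>1 \<subseteq> M" "F \<subseteq> M" "M\<^sub>1 \<inter> F = {}" by (auto simp: M\<^sub>1_def F_def)
  have "\<exists>x. x \<in> Z \<and> {x, y} \<in> E" if "y \<in> M" for y using that M by (auto simp: boundary_def)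
  then obtain p where p: "\<And>y. y \<in> M \<Longrightarrow> p y \<in> Z" "\<And>y. y \<in> M \<Longrightarrow> {p y, y} \<in> E" by metis
  have "\<exists>z. z \<in> X - Z \<and> {z, y} \<in> E \<and> edge_degree S\<^sub>3 z = 0" if "y \<in> F" for y
    using that by (auto simp: F_def)
  then obtain q where q: "\<And>y. y \<in> F \<Longrightarrow> q y \<in> X - Z" "\<And>y. y \<in> F \<Longrightarrow> {q y, y} \<in> E"
    "\<And>y. y \<in> F \<Longrightarrow> edge_degree S\<^sub>3 (q y) = 0" by metis
  define P where "P = (\<lambda>y. {p y, y}) ` M\<^sub>1"
  define val where "val S x = a x + edge_degree P x + edge_degree S x" for S x
  \<comment> \<open>A smallest \<open>bad S\<close> admits no conflict: with \<open>c y\<close> odd, toggling a conflicting edge \<open>xy\<close> would make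
    \<open>val S x\<close> even. The vertices of \<open>T\<close> get their missing 2 on the edge to \<open>q y\<close>.\<close>
  define B where "B = {e \<in> E. \<exists>x \<in> Z. \<exists>y \<in> F. e = {x, y}}"
  define ok where "ok S \<longleftrightarrow> S \<subseteq> B \<and> (\<forall>y \<in> F. edge_degree S y \<ge> 1)" for S
  define bad where "bad S = {x \<in> Z. odd (val S x)}" for S
  have finZ: "finite Z" using Z finite_X finite_subset by blast
  have finM: "finite M" using MY(1) finite_Y by (meson finite_subset subsetI)
  have p_notin: "p y \<notin> M" if "y \<in> M" for y using p(1)[OF that] Z(1) MY(2) by blast
  have q_notin: "q y \<notin> M" if "y \<in> F" for y using q(1)[OF that] MY(2) by blast
  \<comment> \<open>The edges to \<open>p y\<close> form a first \<open>ok\<close> set, so that a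
    minimal one exists.\<close>
  have "edge_degree ((\<lambda>y. {p y, y}) ` F) y = 1" if "y \<in> F" for y
    using edge_degree_pick(1)[of F p y] that p_notin MF(2) by blast
  moreover have "{p y, y} \<in> B" if "y \<in> F" for y
  proof -
    have "y \<in> M" using that MF(2) by blast
    then show ?thesis using p[of y] that unfolding B_def by blast
  qed
  ultimately have "ok ((\<lambda>y. {p y, y}) ` F)" unfolding ok_def by auto
  then obtain S where S: "ok S" and min: "\<And>T. ok T \<Longrightarrow> card (bad S) \<le> card (bad T)"
    using arg_min_nat_lemma[of ok "(\<lambda>y. {p y, y}) ` F" "\<lambda>S. card (bad S)"] by blast
  have SE: "S \<subseteq> E" using S by (auto simp: ok_def B_def)
  then have finS: "finite S" using finite_E finite_subset by blast
  define T where "T = {y \<in> F. even (edge_degree S y)}"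
  define Q where "Q = (\<lambda>y. {q y, y}) ` T"
  \<comment> \<open>\<open>c y\<close> is the final number of 2s at \<open>y\<close> in
    \<open>F\<close>; the edge to \<open>q y\<close> turns an even count into an odd one.\<close>
  define c where "c y = edge_degree S y + (if y \<in> T then 1 else 0)" for y
  have no_conflict: "val S x \<noteq> c y" if xy: "x \<in> Z" "y \<in> F" "{x, y} \<in> E" for x y
  proof
    assume eq: "val S x = c y"
    define S' where "S' = sym_diff S {{x, y}}"
    have a1: "a x \<ge> 1" using xy by (auto simp: Z_def)
    have odd: "odd (val S x)" using eq xy by (auto simp: c_def T_def)
    have par: "odd (edge_degree S' v) \<longleftrightarrow> odd (edge_degree S v) \<noteq> (v = x \<or> v = y)" for v
      using edge_degree_sym_diff_parity[OF finS, of "{{x, y}}" v] by (auto simp: edge_degree_singleton S'_def)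
    have same: "edge_degree S' v = edge_degree S v" if "v \<noteq> x" "v \<noteq> y" for v
      unfolding edge_degree_def S'_def using that by (intro arg_cong[where f = card]) auto
    have finS': "finite S'" using finS by (simp add: S'_def)
    \<comment> \<open>Removing \<open>xy\<close> could violate \<open>ok\<close> only if
      \<open>y\<close> had \<open>S\<close>-degree 1, that is \<open>c y = 1\<close>; but
      \<open>a x\<close> and the edge \<open>xy\<close> already give
      \<open>val S x \<ge> 2\<close>.\<close>
    have y1: "edge_degree S' y \<ge> 1"
    proof (cases "{x, y} \<in> S")
      case False
      then show ?thesis
        using edge_degree_ge_1[OF finS', of "{x, y}" y] by (simp add: S'_def)
    next
      case True
      have "S = S' \<union> {{x, y}}" "S' \<inter> {{x, y}} = {}" using True by (auto simp: S'_def)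
      then have "edge_degree S y = edge_degree S' y + edge_degree {{x, y}} y"
        using edge_degree_Un[of S' "{{x, y}}" y] finS' by simp
      then have *: "edge_degree S y = edge_degree S' y + 1" by (simp add: edge_degree_singleton)
      have "edge_degree S x \<ge> 1" using edge_degree_ge_1[OF finS True, of x] by simp
      then have "val S x \<ge> 2" using a1 by (simp add: val_def)
      then have "edge_degree S y \<noteq> 1" using eq by (auto simp: c_def T_def split: if_splits)
      then show ?thesis using * by simp
    qed
    have "edge_degree S' y' \<ge> 1" if "y' \<in> F" for y'
    proof (cases "y' = y")
      case False
      have "y' \<noteq> x" using that xy(1) MF(2) MY(2) Z(1) by blast
      then show ?thesis using same[of y'] that S False by (simp add: ok_def)
    qed (use y1 in blast)
    moreover have "S' \<subseteq> B" using S xy by (auto simp: ok_def B_def S'_def)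
    ultimately have "ok S'" by (simp add: ok_def)
    moreover have "bad S' = bad S - {x}"
    proof -
      have "v \<in> bad S' \<longleftrightarrow> v \<in> bad S - {x}" for v
      proof (cases "v \<in> Z")
        case True
        then have "v \<noteq> y" using xy(2) MF(2) MY(2) Z(1) by blast
        then show ?thesis
          using par[of x] same[of v] odd True by (cases "v = x") (auto simp: bad_def val_def)
      qed (simp add: bad_def)
      then show ?thesis by blast
    qed
    moreover have "x \<in> bad S" using odd xy by (simp add: bad_def)
    moreover have "finite (bad S)" using finZ by (simp add: bad_def)
    ultimately show False using min[of S'] by (metis card_Diff1_less leD)
  qed
  define S\<^sub>2 where "S\<^sub>2 = P \<union> S \<union> Q"
  have TF: "T \<subseteq> F" by (auto simp: T_def)
  have fin: "finite P" "finite Q"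
    using finite_subset[OF _ finM] MF TF by (simp_all add: P_def Q_def subset_trans[OF TF])
  have Sedge: "\<exists>x y. e = {x, y} \<and> x \<in> Z \<and> y \<in> F" if "e \<in> S" for e
    using S that unfolding ok_def B_def by blast
  have meets_Z: "e \<inter> Z \<noteq> {}" if "e \<in> P \<union> S" for e
  proof (cases "e \<in> S")
    case False
    then obtain y where "y \<in> M\<^sub>1" "e = {p y, y}" using \<open>e \<in> P \<union> S\<close> by (auto simp: P_def)
    then show ?thesis using p(1)[of y] MF(1) by auto
  qed (use Sedge in blast)
  have disj1: "P \<inter> S = {}"
  proof -
    have "y \<notin> e" if "e \<in> S" "y \<in> M\<^sub>1" for e y
      using Sedge[OF that(1)] that(2) MF MY(2)[of y] Z by blast
    then show ?thesis unfolding P_def by blast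
  qed
  have disj2: "(P \<union> S) \<inter> Q = {}"
  proof -
    have "e \<inter> Z = {}" if "e \<in> Q" for e
    proof -
      obtain y where y: "y \<in> T" "e = {q y, y}" using \<open>e \<in> Q\<close> by (auto simp: Q_def)
      then have "y \<notin> Z" "q y \<notin> Z" using TF MF(2) MY(2)[of y] Z(1) q(1)[of y] by auto
      then show ?thesis using y by simp
    qed
    then show ?thesis using meets_Z by blast
  qed
  have deg: "edge_degree S\<^sub>2 v = edge_degree P v + edge_degree S v + edge_degree Q v" for v
    unfolding S\<^sub>2_def using edge_degree_Un disj1 disj2 fin finS by (metis finite_UnI)
  have zero_P: "edge_degree P v = 0" if "v \<notin> M\<^sub>1" "v \<notin> Z" for v
    unfolding P_def using edge_degree_pick(2)[of M\<^sub>1 p v] that p(1) p_notin MF(1) by blast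
  have zero_S: "edge_degree S v = 0" if "v \<notin> F" "v \<notin> Z" for v
    using that Sedge by (intro edge_degree_eq_0) blast
  have zero_Q: "edge_degree Q v = 0" if "v \<notin> T" "v \<notin> q ` T" for v
    unfolding Q_def using edge_degree_pick(2)[of T q v] that q_notin TF MF(2) by blast
  have P1: "edge_degree P y = 1" if "y \<in> M\<^sub>1" for y
    unfolding P_def using edge_degree_pick(1)[of M\<^sub>1 p y] that p_notin MF(1) by blast
  have Q1: "edge_degree Q y = 1" if "y \<in> T" for y
    unfolding Q_def using edge_degree_pick(1)[of T q y] that q_notin TF MF(2) by blast
  \<comment> \<open>Sparseness makes \<open>q\<close> injective on \<open>T\<close>: a vertex off
    \<open>Z\<close> has at most one neighbour in \<open>M\<close>. Hence \<open>q y\<close>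
    receives a single 2.\<close>
  have Qq: "edge_degree Q (q y) = 1" if y: "y \<in> T" for y
  proof -
    have yF: "y \<in> F" using y TF by blast
    have "e = {q y, y}" if e: "e \<in> Q" "q y \<in> e" for e
    proof -
      obtain y' where y': "y' \<in> T" "e = {q y', y'}" using e(1) by (auto simp: Q_def)
      have y'F: "y' \<in> F" using y' TF by blast
      then have "q y \<noteq> y'" using q(1)[OF yF] MF(2) MY(2)[of y'] by blast
      then have "q y' = q y" using e y' by auto
      then have "y' = y"
        using sparse[of y' y "q y"] q(1)[OF yF] q(2)[OF yF] q(2)[OF y'F] yF y'F MF(2) by auto
      then show ?thesis using y' by simp
    qed
    moreover have "{q y, y} \<in> Q" using y by (simp add: Q_def)
    ultimately have "{e \<in> Q. q y \<in> e} = {{q y, y}}" by blast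
    then show ?thesis by (simp add: edge_degree_def)
  qed
  have dZ: "a x + edge_degree S\<^sub>2 x = val S x" "val S x > 0" "b x + edge_degree S\<^sub>3 x = 0" if "x \<in> Z" for x
  proof -
    have "x \<notin> T" using that TF MF(2) MY(2) Z(1) by blast
    moreover have "x \<notin> q ` T" using that TF q(1) by auto
    ultimately have Q: "edge_degree Q x = 0" by (rule zero_Q)
    then show "a x + edge_degree S\<^sub>2 x = val S x" using Q by (simp add: deg val_def)
    show "val S x > 0" using that by (auto simp: val_def Z_def)
    show "b x + edge_degree S\<^sub>3 x = 0"
      using that Z b_X edge_degree_avoiding[OF S3] by auto
  qed
  have dX: "a x + edge_degree S\<^sub>2 x = (if x \<in> q ` T then 1 else 0)" "b x + edge_degree S\<^sub>3 x = edge_degree S\<^sub>3 x"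
    if "x \<in> X" "x \<notin> Z" for x
  proof -
    have "x \<notin> M" using that MY(2) by blast
    then have x: "x \<notin> M\<^sub>1" "x \<notin> F" "x \<notin> T" using MF TF by auto
    have "edge_degree Q x = (if x \<in> q ` T then 1 else 0)"
      using Qq zero_Q[OF x(3)] by auto
    then show "a x + edge_degree S\<^sub>2 x = (if x \<in> q ` T then 1 else 0)"
      using that zero_P[OF x(1)] zero_S[OF x(2)] by (simp add: deg Z_def)
    show "b x + edge_degree S\<^sub>3 x = edge_degree S\<^sub>3 x" using b_X that by simp
  qed
  have qT0: "edge_degree S\<^sub>3 x = 0" if "x \<in> q ` T" for x using that q(3) TF by auto
  have dY: "a y + edge_degree S\<^sub>2 y = (if y \<in> M\<^sub>1 then 1 else if y \<in> F then c y else 0)" if "y \<in> Y" for y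
  proof -
    have y: "y \<notin> X" "y \<notin> Z" "a y = 0" using that disjoint Z a_Y by auto
    then have "y \<notin> q ` T" using q(1) TF by auto
    then have "edge_degree Q y = (if y \<in> T then 1 else 0)" using Q1 zero_Q by simp
    moreover have "edge_degree P y = (if y \<in> M\<^sub>1 then 1 else 0)" using P1 zero_P y by simp
    moreover have "edge_degree S y = 0" if "y \<notin> F" using zero_S y that by simp
    moreover have "y \<notin> F" if "y \<in> M\<^sub>1" using that MF by blast
    ultimately show ?thesis using y TF by (auto simp: deg c_def)
  qed
  have c_pos: "c y \<ge> 1" "y \<in> T \<Longrightarrow> c y \<ge> 3" if "y \<in> F" for y
  proof -
    have "edge_degree S y \<ge> 1" using S that by (simp add: ok_def)
    moreover have "edge_degree S y \<noteq> 1" if "y \<in> T" using that by (auto simp: T_def)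
    ultimately show "c y \<ge> 1" "y \<in> T \<Longrightarrow> c y \<ge> 3" by (fastforce simp: c_def)+
  qed
  have F0: "b y + edge_degree S\<^sub>3 y = 0" if "y \<in> F" for y using that by (simp add: F_def)
  have M1: "b y + edge_degree S\<^sub>3 y > 0" "even (b y + edge_degree S\<^sub>3 y)" if "y \<in> M\<^sub>1" for y
    using that oddY[of y] MY(1)[of y] by (auto simp: M\<^sub>1_def)
  have "P \<subseteq> E" using p(2) MF(1) by (auto simp: P_def)
  moreover have "Q \<subseteq> E" using q(2) TF by (auto simp: Q_def)
  ultimately have "S\<^sub>2 \<subseteq> E" using SE by (simp add: S\<^sub>2_def)
  moreover have "S\<^sub>3 \<subseteq> E" using S3 by (auto simp: avoiding_def)
  moreover have "S\<^sub>2 \<inter> S\<^sub>3 = {}"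
  proof -
    have "(P \<union> S) \<inter> S\<^sub>3 = {}" using S3 meets_Z unfolding avoiding_def by blast
    moreover have "e \<notin> S\<^sub>3" if "e \<in> Q" for e
    proof
      assume "e \<in> S\<^sub>3"
      then obtain y where "y \<in> T" "e = {q y, y}" using \<open>e \<in> Q\<close> by (auto simp: Q_def)
      then show False
        using edge_degree_ge_1[OF finS3 \<open>e \<in> S\<^sub>3\<close>, of "q y"] qT0 by auto
    qed
    ultimately show ?thesis by (auto simp: S\<^sub>2_def)
  qed
  moreover have "admissible (a v + edge_degree S\<^sub>2 v) (b v + edge_degree S\<^sub>3 v)" if "v \<in> X \<union> Y" for v
  proof -
    consider "v \<in> Z" | "v \<in> X" "v \<notin> Z" | "v \<in> Y" using \<open>v \<in> X \<union> Y\<close> by blast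
    then show ?thesis
    proof cases
      case 1
      then show ?thesis using dZ by (simp add: admissible_def)
    next
      case 2
      then show ?thesis using dX[OF 2] qT0[of v] by (auto simp: admissible_def)
    next
      case 3
      then show ?thesis using dY[OF 3] M1[of v] F0[of v] by (simp add: admissible_def)
    qed
  qed
  moreover have "(a x + edge_degree S\<^sub>2 x, b x + edge_degree S\<^sub>3 x) \<noteq>
      (a y + edge_degree S\<^sub>2 y, b y + edge_degree S\<^sub>3 y)"
    if xy: "x \<in> X" "y \<in> Y" "{x, y} \<in> E" for x y
  proof (cases "y \<in> M")
    case False
    then have "odd (b y + edge_degree S\<^sub>3 y)" using oddY xy by simp
    moreover have "even (b x + edge_degree S\<^sub>3 x)" using evenX b_X xy by simp
    ultimately show ?thesis by (metis prod.inject)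
  next
    case y: True
    show ?thesis
    proof (cases "x \<in> Z")
      case True
      then show ?thesis
        using dZ[of x] dY[OF xy(2)] M1[of y] no_conflict[of x y] xy(3) by auto
    next
      case False
      show ?thesis
      proof (cases "y \<in> F")
        case F: True
        \<comment> \<open>Here \<open>x\<close> has one 2. Sparseness shows that it got it from
          \<open>y\<close> itself, so \<open>y\<close> is in \<open>T\<close> and has at least three
          2s.\<close>
        have "c y \<noteq> 1" if x: "x \<in> q ` T"
        proof -
          obtain y' where y': "y' \<in> T" "x = q y'" using x by blast
          then have "y' \<in> F" using TF by blast
          then have "y' = y" using sparse[of y' y x] y y'(2) xy(3) False q(2)[of y'] MF(2) by blast
          then show ?thesis using y' c_pos(2)[OF F] by auto
        qed
        then show ?thesis
          using dX[OF xy(1) False] dY[OF xy(2)] c_pos(1)[OF F] F MF(3) by auto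
      next
        case notF: False
        show ?thesis
        proof (cases "y \<in> M\<^sub>1")
          case True
          then show ?thesis using dX[OF xy(1) False] dY[OF xy(2)] M1[OF True] qT0[of x] by auto
        next
          case notM: False
          then have "b y + edge_degree S\<^sub>3 y = 0" using y by (simp add: M\<^sub>1_def)
          moreover have "edge_degree S\<^sub>3 x \<noteq> 0"
            using notF y calculation xy False by (auto simp: F_def)
          ultimately show ?thesis using dX(2)[OF xy(1) False] by auto
        qed
      qed
    qed
  qed
  ultimately have "separating S\<^sub>2 S\<^sub>3" unfolding separating_def by blast
  then show ?thesis by blast
qed

lemma separatingI:
  assumes "S\<^sub>2 \<subseteq> E" "S\<^sub>3 \<subseteq> E" "S\<^sub>2 \<inter> S\<^sub>3 = {}"
    and "\<And>x. x \<in> X \<Longrightarrow> admissible (a x + edge_degree S\<^sub>2 x) (edge_degree S\<^sub>3 x)"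
    and "\<And>y. y \<in> Y \<Longrightarrow> admissible (edge_degree S\<^sub>2 y) (b y + edge_degree S\<^sub>3 y)"
    and "\<And>x y. x \<in> X \<Longrightarrow> y \<in> Y \<Longrightarrow> {x, y} \<in> E \<Longrightarrow>
      a x + edge_degree S\<^sub>2 x = edge_degree S\<^sub>2 y \<Longrightarrow>
      edge_degree S\<^sub>3 x = b y + edge_degree S\<^sub>3 y \<Longrightarrow> False"
  shows "separating S\<^sub>2 S\<^sub>3"
  unfolding separating_def using assms a_Y b_X by auto

text \<open>Here a single vertex \<open>x\<^sub>0\<close> of \<open>X\<close> plays the role of \<open>Z\<close>. The delicate case is that \<open>M\<close> consists of
  one leaf \<open>y\<close> without any 3; then the parities are exchanged to even on \<open>Y\<close> and odd on \<open>X\<close>,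
  with \<open>x\<^sub>0\<close> absorbing the wrong ones.\<close>

lemma separating_if_zero:
  assumes a0: "\<And>x. x \<in> X \<Longrightarrow> a x = 0"
    and nontrivial: "\<And>x y. X = {x} \<Longrightarrow> Y = {y} \<Longrightarrow> b y \<noteq> 0"
  shows "\<exists>S\<^sub>2 S\<^sub>3. separating S\<^sub>2 S\<^sub>3"
proof (cases "E = {}")
  case True
  then have "separating {} {}"
    by (intro separatingI) (auto simp: a0 admissible_def)
  then show ?thesis by blast
next
  case False
  then obtain x\<^sub>0 where x0: "x\<^sub>0 \<in> X" using edgeE by blast
  define Z where "Z = {x\<^sub>0}"
  have Z: "Z \<subseteq> X" "Z \<noteq> {}" "x\<^sub>0 \<in> Z" using x0 by (auto simp: Z_def)
  define R where "R = boundary Z"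
  have R: "y \<in> R \<longleftrightarrow> y \<in> Y \<and> {x\<^sub>0, y} \<in> E" for y by (auto simp: R_def boundary_def Z_def)
  have x0R: "x\<^sub>0 \<notin> R" using x0 disjoint by (auto simp: R)
  have YX: "y \<notin> X" "y \<noteq> x\<^sub>0" if "y \<in> Y" for y using that disjoint x0 by auto
  have finR: "finite R" using finite_Y by (rule rev_finite_subset) (auto simp: R)
  define star where "star N = (\<lambda>y. {x\<^sub>0, y}) ` N" for N
  have star: "edge_degree (star N) v = (if v = x\<^sub>0 then card N else if v \<in> N then 1 else 0)"
    if "N \<subseteq> R" for N v
    unfolding star_def using that x0R by (intro edge_degree_star) auto
  have star_E: "star N \<subseteq> E" if "N \<subseteq> R" for N using that by (auto simp: star_def R)
  have avoid: "S \<subseteq> E" "star N \<inter> S = {}" if "S \<subseteq> avoiding Z" for S N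
    using that by (auto simp: avoiding_def Z_def star_def)
  obtain S\<^sub>3 M where S3: "S\<^sub>3 \<subseteq> avoiding Z" and M: "M \<subseteq> R"
    and evenX: "\<And>x. x \<in> X \<Longrightarrow> even (edge_degree S\<^sub>3 x)"
    and oddY: "\<And>y. y \<in> Y \<Longrightarrow> odd (b y + edge_degree S\<^sub>3 y) \<longleftrightarrow> y \<notin> M"
    using sparse_even_set[OF Z(1,2)] unfolding R_def by metis
  have zero: "edge_degree S\<^sub>3 x\<^sub>0 = 0" using edge_degree_avoiding[OF S3 Z(3)] .
  show ?thesis
  proof (cases "\<exists>y. M = {y} \<and> b y + edge_degree S\<^sub>3 y = 0")
    case False
    have d2: "edge_degree (star M) v = (if v = x\<^sub>0 then card M else if v \<in> M then 1 else 0)" for v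
      using star[OF M] .
    \<comment> \<open>Off \<open>M\<close> the parity of 3s decides. A vertex of \<open>M\<close>
      has one 2, so it can tie only with \<open>x\<^sub>0\<close>, and only if it is all of
      \<open>M\<close> and has no 3; this case excludes that.\<close>
    have "separating (star M) S\<^sub>3"
    proof (rule separatingI)
      fix x assume "x \<in> X"
      then show "admissible (a x + edge_degree (star M) x) (edge_degree S\<^sub>3 x)"
        using M zero YX(1)[of x] by (auto simp: d2 a0 admissible_def R)
    next
      fix y assume "y \<in> Y"
      then show "admissible (edge_degree (star M) y) (b y + edge_degree S\<^sub>3 y)"
        using oddY[of y] YX(2)[of y] by (auto simp: d2 admissible_def)
    next
      fix x y assume xy: "x \<in> X" "y \<in> Y" "{x, y} \<in> E"
        "a x + edge_degree (star M) x = edge_degree (star M) y"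
        "edge_degree S\<^sub>3 x = b y + edge_degree S\<^sub>3 y"
      then have "y \<in> M" using oddY[of y] evenX[of x] by metis
      moreover have "x \<notin> M" using xy(1) M YX(1)[of x] by (auto simp: R)
      ultimately have "x = x\<^sub>0" "card M = 1"
        using xy YX(2)[of y] by (auto simp: d2 a0 split: if_splits)
      then have "M = {y}" using \<open>y \<in> M\<close> by (metis card_1_singletonE singletonD)
      then show False using False xy(5) zero \<open>x = x\<^sub>0\<close> by auto
    qed (use star_E[OF M] avoid[OF S3] in auto)
    then show ?thesis by blast
  next
    case True
    then obtain y where y: "M = {y}" "b y = 0" "edge_degree S\<^sub>3 y = 0" by auto
    have yR: "y \<in> R" "y \<in> Y" "{x\<^sub>0, y} \<in> E" using y M by (auto simp: R)
    show ?thesis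
    proof (cases "\<exists>u. u \<noteq> x\<^sub>0 \<and> {u, y} \<in> E")
      case True
      then obtain u where u: "u \<noteq> x\<^sub>0" "{u, y} \<in> E" by blast
      have uX: "u \<in> X" using edge_cases[OF u(2)] YX(1)[OF yR(2)] by blast
      \<comment> \<open>This gives \<open>y\<close> the pair \<open>(2, 0)\<close>, while no vertex
        of \<open>X\<close> gets more than one 2; the rest of \<open>Y\<close> still differs from
        \<open>X\<close> in the parity of 3s.\<close>
      let ?S = "(\<lambda>x. {y, x}) ` {x\<^sub>0, u}"
      have d2: "edge_degree ?S v = (if v = y then 2 else if v \<in> {x\<^sub>0, u} then 1 else 0)" for v
      proof -
        have "y \<notin> {x\<^sub>0, u}" using YX[OF yR(2)] uX by auto
        then show ?thesis using u(1) by (subst edge_degree_star) auto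
      qed
      have "e \<notin> S\<^sub>3" if "e \<in> ?S" for e
      proof
        assume "e \<in> S\<^sub>3"
        moreover have "finite S\<^sub>3" using avoid(1)[OF S3] finite_E by (rule finite_subset)
        ultimately have "edge_degree S\<^sub>3 y \<ge> 1" using \<open>e \<in> ?S\<close> by (intro edge_degree_ge_1) auto
        then show False using y(3) by simp
      qed
      then have "?S \<inter> S\<^sub>3 = {}" by blast
      have "separating ?S S\<^sub>3"
      proof (rule separatingI)
        show "?S \<subseteq> E" using u(2) yR(3) by (auto simp: insert_commute)
      next
        fix x assume "x \<in> X"
        then show "admissible (a x + edge_degree ?S x) (edge_degree S\<^sub>3 x)"
          using YX(1)[OF yR(2)] evenX[of x] unfolding d2 by (auto simp: a0 admissible_def)
      next
        fix y' assume y': "y' \<in> Y"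
        then show "admissible (edge_degree ?S y') (b y' + edge_degree S\<^sub>3 y')"
          using y YX[OF y'] uX unfolding d2 by (auto simp: admissible_def)
      next
        fix x y' assume xy: "x \<in> X" "y' \<in> Y" "{x, y'} \<in> E"
          "a x + edge_degree ?S x = edge_degree ?S y'"
          "edge_degree S\<^sub>3 x = b y' + edge_degree S\<^sub>3 y'"
        then have "y' = y" using oddY[of y'] evenX[of x] y(1) by (metis singletonD)
        then show False using xy YX(1)[OF yR(2)] unfolding d2 by (auto simp: a0 split: if_splits)
      qed (use \<open>?S \<inter> S\<^sub>3 = {}\<close> avoid[OF S3] in auto)
      then show ?thesis by blast
    next
      case False
      then have leaf: "u = x\<^sub>0" if "{u, y} \<in> E" for u using that by blast
      \<comment> \<open>The exchanged parities: odd on \<open>X\<close> except at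
        \<open>x\<^sub>0\<close>, even totals on \<open>Y\<close>. Wrong totals can remain only on
        \<open>R\<close>.\<close>
      define A where "A = (X - {x\<^sub>0}) \<union> {y \<in> Y. odd (b y)}"
      have "A \<subseteq> X \<union> Y" "A \<inter> Z = {}" using YX by (auto simp: A_def Z_def)
      then obtain S where S: "S \<subseteq> avoiding Z"
        and parity: "\<And>v. v \<notin> R \<Longrightarrow> odd (edge_degree S v) \<longleftrightarrow> v \<in> A"
        using parity_avoiding[OF Z(1,2)] unfolding R_def by metis
      have isolated: "y \<notin> e" if e: "e \<in> avoiding Z" for e
      proof
        assume "y \<in> e"
        obtain p q where "p \<in> X" "q \<in> Y" "e = {p, q}"
          using edgeE[of e] e unfolding avoiding_def by blast
        then have "e = {p, y}" using \<open>y \<in> e\<close> YX(1)[OF yR(2)] by auto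
        then have "p = x\<^sub>0" using leaf e by (auto simp: avoiding_def)
        then show False using e \<open>e = {p, y}\<close> by (auto simp: avoiding_def Z_def)
      qed
      have Sy: "edge_degree S y = 0" using isolated S by (intro edge_degree_eq_0) auto
      have Sx0: "edge_degree S x\<^sub>0 = 0" using edge_degree_avoiding[OF S Z(3)] .
      \<comment> \<open>A 3 on the edge to \<open>x\<^sub>0\<close> repairs each wrong total on
        \<open>R\<close>; \<open>x\<^sub>0\<close> thereby gets \<open>card R\<^sub>o\<close> labels
        3.\<close>
      define R\<^sub>o where "R\<^sub>o = {r \<in> R. odd (b r + edge_degree S r)}"
      have Ro: "R\<^sub>o \<subseteq> R" "y \<notin> R\<^sub>o" using y(2) Sy by (auto simp: R\<^sub>o_def)
      have fin: "finite S" "finite (star R\<^sub>o)"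
        using avoid(1)[OF S] star_E[OF Ro(1)] finite_E finite_subset by blast+
      have d3: "edge_degree (S \<union> star R\<^sub>o) v =
        edge_degree S v + (if v = x\<^sub>0 then card R\<^sub>o else if v \<in> R\<^sub>o then 1 else 0)" for v
        using edge_degree_Un[OF fin] avoid(2)[OF S, of R\<^sub>o] star[OF Ro(1)] by (simp add: Int_commute)
      have evenY: "even (b v + edge_degree (S \<union> star R\<^sub>o) v)" if "v \<in> Y" for v
        using YX[OF that] that parity[of v] unfolding d3 by (cases "v \<in> R") (auto simp: R\<^sub>o_def A_def)
      have oddX: "odd (edge_degree (S \<union> star R\<^sub>o) v)" if "v \<in> X" "v \<noteq> x\<^sub>0" for v
      proof -
        have "v \<notin> R" using that YX by (auto simp: R)
        then show ?thesis using that parity[of v] Ro(1) unfolding d3 by (auto simp: A_def)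
      qed
      \<comment> \<open>If the leaf \<open>y\<close> were the only neighbour of
        \<open>x\<^sub>0\<close>, connectedness would leave just the edge between them, which
        \<open>nontrivial\<close> excludes since \<open>b y = 0\<close>.\<close>
      have "\<exists>r \<in> R. r \<noteq> y"
      proof (rule ccontr)
        assume "\<not> (\<exists>r \<in> R. r \<noteq> y)"
        then have "R = {y}" using yR by blast
        have "v = y" if v: "v \<in> X \<union> Y" "v \<noteq> x\<^sub>0" for v
        proof -
          have "(v, y) \<in> (edge_rel (avoiding Z))\<^sup>*"
            using reach_boundary[OF Z(1) connected[OF v(1)] Z(3)] x0 v(2) \<open>R = {y}\<close>
            by (auto simp: R_def Z_def)
          then show ?thesis
          proof (cases rule: rtranclE)
            case (step w)
            then show ?thesis using isolated[of "{w, y}"] by (auto simp: edge_rel_def)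
          qed
        qed
        then have "X = {x\<^sub>0}" "Y = {y}" using x0 yR YX by blast+
        then show False using nontrivial y(2) by blast
      qed
      then obtain r where r: "r \<in> R" "r \<noteq> y" by blast
      \<comment> \<open>If \<open>card R\<^sub>o\<close> is odd, parity separates
        \<open>x\<^sub>0\<close> too. If it is even and positive, \<open>x\<^sub>0\<close> gets
        \<open>(1, card R\<^sub>o)\<close> and \<open>y\<close>, the only vertex of \<open>Y\<close>
        with a 2, gets \<open>(1, 0)\<close>. If it is 0, \<open>x\<^sub>0\<close> gets two 2s and
        each vertex of \<open>Y\<close> at most one.\<close>
      define N where "N = (if odd (card R\<^sub>o) then {} else if card R\<^sub>o > 0 then {y} else {y, r})"
      have N: "N \<subseteq> R" "N \<inter> R\<^sub>o = {}"
        using yR r Ro finR finite_subset[OF Ro(1) finR] by (auto simp: N_def)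
      have d2: "edge_degree (star N) v = (if v = x\<^sub>0 then card N else if v \<in> N then 1 else 0)" for v
        using star[OF N(1)] .
      have cardN: "card N = (if odd (card R\<^sub>o) then 0 else if card R\<^sub>o > 0 then 1 else 2)"
        using r by (auto simp: N_def)
      have "separating (star N) (S \<union> star R\<^sub>o)"
      proof (rule separatingI)
        show "star N \<inter> (S \<union> star R\<^sub>o) = {}"
        proof -
          have "star N \<inter> star R\<^sub>o = {}" using N(2) by (auto simp: star_def doubleton_eq_iff)
          then show ?thesis using avoid(2)[OF S, of N] by blast
        qed
      next
        fix x assume x: "x \<in> X"
        have "x \<notin> N" using x YX(1)[of x] N(1) by (auto simp: R)
        then show "admissible (a x + edge_degree (star N) x) (edge_degree (S \<union> star R\<^sub>o) x)"
          using x unfolding d2 d3 by (auto simp: a0 Sx0 cardN admissible_def)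
      next
        fix v assume v: "v \<in> Y"
        then show "admissible (edge_degree (star N) v) (b v + edge_degree (S \<union> star R\<^sub>o) v)"
          using evenY[OF v] YX(2)[OF v] unfolding d2 by (auto simp: admissible_def)
      next
        fix x v assume xv: "x \<in> X" "v \<in> Y" "{x, v} \<in> E"
          "a x + edge_degree (star N) x = edge_degree (star N) v"
          "edge_degree (S \<union> star R\<^sub>o) x = b v + edge_degree (S \<union> star R\<^sub>o) v"
        have "x = x\<^sub>0" using evenY[OF xv(2)] oddX[OF xv(1)] xv(5) by metis
        moreover have "edge_degree (S \<union> star R\<^sub>o) x\<^sub>0 = card R\<^sub>o" by (simp add: d3 Sx0)
        ultimately have k: "even (card R\<^sub>o)" using evenY[OF xv(2)] xv(5) by simp
        have "card N = (if v \<in> N then 1 else 0)"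
          using xv(4) \<open>x = x\<^sub>0\<close> YX(2)[OF xv(2)] unfolding d2 by (simp add: a0[OF x0])
        then have "card R\<^sub>o > 0" "v \<in> N" unfolding cardN using k
          by (cases "card R\<^sub>o > 0"; cases "v \<in> N"; simp)+
        then have "v = y" using k by (simp add: N_def)
        then show False
          using xv(5) \<open>card R\<^sub>o > 0\<close> \<open>x = x\<^sub>0\<close> Sx0 Sy y(2) Ro(2) YX(2)[OF yR(2)] by (simp add: d3)
      qed (use star_E[OF N(1)] avoid(1)[OF S] star_E[OF Ro(1)] in auto)
      then show ?thesis by blast
    qed
  qed
qed

lemma separating_exists:
  assumes "\<And>x y. X = {x} \<Longrightarrow> Y = {y} \<Longrightarrow> a x \<noteq> 0 \<or> b y \<noteq> 0"
  shows "\<exists>S\<^sub>2 S\<^sub>3. separating S\<^sub>2 S\<^sub>3"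
proof (cases "\<exists>x \<in> X. a x > 0")
  case True
  then show ?thesis using separating_if_positive by blast
next
  case False
  then have a0: "\<And>x. x \<in> X \<Longrightarrow> a x = 0" by auto
  show ?thesis
  proof (rule separating_if_zero[OF a0])
    fix x y assume "X = {x}" "Y = {y}"
    then show "b y \<noteq> 0" using assms[of x y] a0[of x] by simp
  qed
qed

end

section \<open>From connected components to arbitrary bipartite graphs\<close>

context weighted_bipartite
begin

text \<open>A component with one vertex in each part is an isolated edge, and there
  \<open>isolated\<close> supplies the non-zero weight that the connected case asks for.\<close>

lemma component_separating:
  fixes v
  defines "C \<equiv> {u. (v, u) \<in> (edge_rel E)\<^sup>*}"
  assumes isolated: "\<And>x y. {x, y} \<in> E \<Longrightarrow> x \<in> X \<Longrightarrow> y \<in> Y \<Longrightarrow> (\<And>v. {x, v} \<in> E \<Longrightarrow> v = y) \<Longrightarrow>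
      (\<And>u. {u, y} \<in> E \<Longrightarrow> u = x) \<Longrightarrow> a x \<noteq> 0 \<or> b y \<noteq> 0"
  shows "\<exists>S\<^sub>2 S\<^sub>3. weighted_bipartite.separating (X \<inter> C) (Y \<inter> C) {e \<in> E. e \<subseteq> C} a b S\<^sub>2 S\<^sub>3"
proof -
  have step: "u \<in> C \<longleftrightarrow> w \<in> C" if "{u, w} \<in> E" for u w
  proof -
    have "u = w \<or> (u, w) \<in> edge_rel E \<and> (w, u) \<in> edge_rel E"
      using that by (auto simp: edge_rel_def insert_commute)
    then show ?thesis unfolding C_def by (auto intro: rtrancl_into_rtrancl)
  qed
  have reach: "u \<in> C \<Longrightarrow> (u, w) \<in> (edge_rel E)\<^sup>* \<Longrightarrow> (u, w) \<in> (edge_rel {e \<in> E. e \<subseteq> C})\<^sup>* \<and> w \<in> C" for u w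
  proof (rotate_tac 1, induction rule: rtrancl_induct)
    case (step p q)
    then have "{p, q} \<in> E" "p \<noteq> q" by (auto simp: edge_rel_def)
    then have "(p, q) \<in> edge_rel {e \<in> E. e \<subseteq> C}" "q \<in> C"
      using step \<open>\<And>u w. {u, w} \<in> E \<Longrightarrow> (u \<in> C) = (w \<in> C)\<close>[of p q] by (auto simp: edge_rel_def)
    then show ?case using step by (meson rtrancl_into_rtrancl)
  qed auto
  have "sym ((edge_rel E)\<^sup>*)" by (intro sym_rtrancl symI) (auto simp: edge_rel_def insert_commute)
  then have conn: "(u, w) \<in> (edge_rel E)\<^sup>*" if "u \<in> C" "w \<in> C" for u w
    using that unfolding C_def by (metis mem_Collect_eq rtrancl_trans symE)
  interpret C: connected_weighted_bipartite "X \<inter> C" "Y \<inter> C" "{e \<in> E. e \<subseteq> C}" a b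
  proof unfold_locales
    fix e assume "e \<in> {e \<in> E. e \<subseteq> C}"
    then show "\<exists>x \<in> X \<inter> C. \<exists>y \<in> Y \<inter> C. e = {x, y}" using edgeE[of e] by auto
  next
    fix u w assume "u \<in> X \<inter> C \<union> Y \<inter> C" "w \<in> X \<inter> C \<union> Y \<inter> C"
    then show "(u, w) \<in> (edge_rel {e \<in> E. e \<subseteq> C})\<^sup>*" using reach[of u w] conn[of u w] by blast
  qed (use finite_X finite_Y disjoint a_Y b_X in auto)
  show ?thesis
  proof (rule C.separating_exists)
    fix x y assume xy: "X \<inter> C = {x}" "Y \<inter> C = {y}"
    then have *: "x \<in> X" "y \<in> Y" "x \<in> C" "y \<in> C" "x \<noteq> y" using disjoint by auto
    have y: "w = y" if "{x, w} \<in> E" for w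
    proof -
      have "w \<in> Y" using edge_cases[OF that] *(1) disjoint by blast
      then show ?thesis using step[OF that] * xy by blast
    qed
    have x: "w = x" if "{w, y} \<in> E" for w
    proof -
      have "w \<in> X" using edge_cases[OF that] *(2) disjoint by blast
      then show ?thesis using step[OF that] * xy by blast
    qed
    obtain w where "(x, w) \<in> edge_rel E"
      using conn[OF *(3,4)] *(5) by (auto elim: converse_rtranclE)
    then have "{x, y} \<in> E" using y[of w] by (auto simp: edge_rel_def)
    then show "a x \<noteq> 0 \<or> b y \<noteq> 0" using isolated[of x y] * x y by blast
  qed
qed

text \<open>No edge leaves a component, so degrees and conflicts are local and the solutions of the
  components can be united.\<close>

lemma separating_all_components:
  assumes isolated: "\<And>x y. {x, y} \<in> E \<Longrightarrow> x \<in> X \<Longrightarrow> y \<in> Y \<Longrightarrow> (\<And>v. {x, v} \<in> E \<Longrightarrow> v = y) \<Longrightarrow>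
      (\<And>u. {u, y} \<in> E \<Longrightarrow> u = x) \<Longrightarrow> a x \<noteq> 0 \<or> b y \<noteq> 0"
  shows "\<exists>S\<^sub>2 S\<^sub>3. separating S\<^sub>2 S\<^sub>3"
proof -
  define comp where "comp v = {u. (v, u) \<in> (edge_rel E)\<^sup>*}" for v
  let ?sep = "\<lambda>C. weighted_bipartite.separating (X \<inter> C) (Y \<inter> C) {e \<in> E. e \<subseteq> C} a b"
  have sym: "sym ((edge_rel E)\<^sup>*)" by (intro sym_rtrancl symI) (auto simp: edge_rel_def insert_commute)
  have self: "v \<in> comp v" for v by (simp add: comp_def)
  have comp_eq: "comp u = comp v" if "u \<in> comp v" for u v
    using that symD[OF sym] unfolding comp_def by (auto intro: rtrancl_trans)
  \<comment> \<open>The choice is a function of the component, not of a vertex in it, so all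
    vertices of a component see the same solution.\<close>
  define g where "g C = (SOME S. ?sep C (fst S) (snd S))" for C
  have g: "?sep (comp v) (fst (g (comp v))) (snd (g (comp v)))" for v
  proof -
    have "\<exists>S\<^sub>2 S\<^sub>3. ?sep (comp v) S\<^sub>2 S\<^sub>3"
      unfolding comp_def using isolated by (rule component_separating)
    then obtain S\<^sub>2 S\<^sub>3 where "?sep (comp v) S\<^sub>2 S\<^sub>3" by (elim exE)
    then show ?thesis
      using someI[of "\<lambda>S. ?sep (comp v) (fst S) (snd S)" "(S\<^sub>2, S\<^sub>3)"] by (simp add: g_def)
  qed
  have wb: "weighted_bipartite (X \<inter> comp v) (Y \<inter> comp v) {e \<in> E. e \<subseteq> comp v} a b" for v
  proof unfold_locales
    fix e assume "e \<in> {e \<in> E. e \<subseteq> comp v}"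
    then show "\<exists>x \<in> X \<inter> comp v. \<exists>y \<in> Y \<inter> comp v. e = {x, y}" using edgeE[of e] by auto
  qed (use finite_X finite_Y disjoint a_Y b_X in auto)
  note g' = g[unfolded weighted_bipartite.separating_def[OF wb]]
  define S\<^sub>2 where "S\<^sub>2 = (\<Union>v. fst (g (comp v)))"
  define S\<^sub>3 where "S\<^sub>3 = (\<Union>v. snd (g (comp v)))"
  have sub: "fst (g (comp v)) \<subseteq> {e \<in> E. e \<subseteq> comp v}" "snd (g (comp v)) \<subseteq> {e \<in> E. e \<subseteq> comp v}" for v
    using g'[of v] by blast+
  have local: "e \<in> S\<^sub>2 \<longleftrightarrow> e \<in> fst (g (comp v))" "e \<in> S\<^sub>3 \<longleftrightarrow> e \<in> snd (g (comp v))" if "v \<in> e" for e v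
  proof -
    have "e \<in> h (g (comp v))" if "e \<in> h (g (comp u))" "h = fst \<or> h = snd" for u h
    proof -
      have "v \<in> comp u" using that sub[of u] \<open>v \<in> e\<close> by blast
      then show ?thesis using comp_eq that by metis
    qed
    then show "e \<in> S\<^sub>2 \<longleftrightarrow> e \<in> fst (g (comp v))" "e \<in> S\<^sub>3 \<longleftrightarrow> e \<in> snd (g (comp v))"
      unfolding S\<^sub>2_def S\<^sub>3_def by blast+
  qed
  have deg: "edge_degree S\<^sub>2 v = edge_degree (fst (g (comp v))) v"
    "edge_degree S\<^sub>3 v = edge_degree (snd (g (comp v))) v" for v
    unfolding edge_degree_def using local by (metis (mono_tags, lifting))+
  have "separating S\<^sub>2 S\<^sub>3"
    unfolding separating_def
  proof (intro conjI ballI impI)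
    show "S\<^sub>2 \<subseteq> E" "S\<^sub>3 \<subseteq> E" using sub by (auto simp: S\<^sub>2_def S\<^sub>3_def)
    show "S\<^sub>2 \<inter> S\<^sub>3 = {}"
    proof (rule ccontr)
      assume "S\<^sub>2 \<inter> S\<^sub>3 \<noteq> {}"
      then obtain e where e: "e \<in> S\<^sub>2" "e \<in> S\<^sub>3" by blast
      then have "e \<in> E" using \<open>S\<^sub>2 \<subseteq> E\<close> by blast
      then obtain v where "v \<in> e" using edgeE by blast
      then show False using e local[of v e] g'[of v] by blast
    qed
  next
    fix v assume "v \<in> X \<union> Y"
    then show "admissible (a v + edge_degree S\<^sub>2 v) (b v + edge_degree S\<^sub>3 v)"
      unfolding deg using g'[of v] self[of v] by blast
  next
    fix x y assume xy: "x \<in> X" "y \<in> Y" "{x, y} \<in> E"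
    have "x \<noteq> y" using xy disjoint by blast
    then have "(x, y) \<in> edge_rel E" using xy by (simp add: edge_rel_def)
    then have y: "y \<in> comp x" by (auto simp: comp_def)
    then have "comp y = comp x" by (rule comp_eq)
    moreover have "{x, y} \<in> {e \<in> E. e \<subseteq> comp x}" using xy y self by simp
    ultimately show "(a x + edge_degree S\<^sub>2 x, b x + edge_degree S\<^sub>3 x) \<noteq>
        (a y + edge_degree S\<^sub>2 y, b y + edge_degree S\<^sub>3 y)"
      unfolding deg using g'[of x] xy y self[of x] by auto
  qed
  then show ?thesis by blast
qed

end

section \<open>Colourings with minimal colour sum\<close>

text \<open>The smallest positive colour with the parity of \<open>i\<close>.\<close>

definition parity_class :: "nat \<Rightarrow> nat" where
  "parity_class i = (if odd i then 1 else 2)"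

locale finite_simple_graph =
  fixes V :: "'a set" and E :: "'a set set"
  assumes finite_V: "finite V"
    and edgeE: "\<And>e. e \<in> E \<Longrightarrow> \<exists>u \<in> V. \<exists>v \<in> V. u \<noteq> v \<and> e = {u, v}"
begin

lemma edge_verts: "{u, v} \<in> E \<Longrightarrow> u \<in> V \<and> v \<in> V \<and> u \<noteq> v"
  using edgeE[of "{u, v}"] by (auto simp: doubleton_eq_iff)

lemma finite_E: "finite E"
  using finite_subset[of E "Pow V"] finite_V edgeE by blast

definition proper :: "('a \<Rightarrow> nat) \<Rightarrow> bool" where
  "proper c \<longleftrightarrow> (\<forall>v \<in> V. c v \<ge> 1) \<and> (\<forall>u v. {u, v} \<in> E \<longrightarrow> c u \<noteq> c v)"

definition optimal :: "('a \<Rightarrow> nat) \<Rightarrow> bool" where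
  "optimal c \<longleftrightarrow> proper c \<and> (\<forall>c'. proper c' \<longrightarrow> (\<Sum>v\<in>V. c v) \<le> (\<Sum>v\<in>V. c' v))"

lemma ex_optimal: "\<exists>c. optimal c"
proof -
  obtain f :: "'a \<Rightarrow> nat" where f: "inj_on f V"
    using finite_imp_inj_to_nat_seg[OF finite_V] by blast
  have "proper (\<lambda>v. Suc (f v))"
    unfolding proper_def using f edge_verts by (auto dest!: inj_onD)
  then show ?thesis
    unfolding optimal_def using ex_has_least_nat[of proper _ "\<lambda>c. \<Sum>v\<in>V. c v"] by blast
qed

text \<open>Otherwise recolouring \<open>v\<close> with \<open>j\<close> would give a smaller colour
  sum.\<close>

lemma optimal_neighbour:
  assumes c: "optimal c" and v: "v \<in> V" and j: "1 \<le> j" "j < c v"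
  shows "\<exists>u. {u, v} \<in> E \<and> c u = j"
proof (rule ccontr)
  assume none: "\<not> ?thesis"
  let ?c = "c(v := j)"
  have "?c u \<noteq> ?c w" if "{u, w} \<in> E" for u w
  proof -
    have "c u \<noteq> c w" "u \<noteq> w" using c that edge_verts by (auto simp: optimal_def proper_def)
    moreover have "{w, u} \<in> E" using that by (simp add: insert_commute)
    ultimately show ?thesis using none that by auto
  qed
  then have "proper ?c" using c j by (auto simp: optimal_def proper_def)
  moreover have "(\<Sum>u\<in>V. ?c u) < (\<Sum>u\<in>V. c u)"
    using finite_V v j by (intro sum_strict_mono_ex1) auto
  ultimately show False using c unfolding optimal_def by fastforce
qed

section \<open>Isolated edges of the subgraph on the colours 1 and 2: swaps and anchors\<close>

definition low_edge :: "('a \<Rightarrow> nat) \<Rightarrow> 'a \<Rightarrow> 'a \<Rightarrow> bool" where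
  "low_edge c u v \<longleftrightarrow> {u, v} \<in> E \<and> c u \<le> 2 \<and> c v \<le> 2 \<and>
    (\<forall>x. {u, x} \<in> E \<longrightarrow> c x \<le> 2 \<longrightarrow> x = v) \<and> (\<forall>x. {v, x} \<in> E \<longrightarrow> c x \<le> 2 \<longrightarrow> x = u)"

lemma low_edge_sym: "low_edge c u v \<Longrightarrow> low_edge c v u"
  by (auto simp: low_edge_def insert_commute[of v u])

lemma low_edge_unique: "low_edge c u v \<Longrightarrow> low_edge c u w \<Longrightarrow> v = w"
  unfolding low_edge_def by blast

definition low_edges :: "('a \<Rightarrow> nat) \<Rightarrow> 'a set set" where
  "low_edges c = {{u, v} | u v. low_edge c u v}"

lemma low_edges_disjoint: "e \<in> low_edges c \<Longrightarrow> e' \<in> low_edges c \<Longrightarrow> u \<in> e \<Longrightarrow> u \<in> e' \<Longrightarrow> e = e'"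
  unfolding low_edges_def by clarsimp (metis insertE insert_commute low_edge_sym low_edge_unique singletonD)

lemma low_edge_colours:
  assumes "proper c" "low_edge c u v"
  shows "c u = 1 \<and> c v = 2 \<or> c u = 2 \<and> c v = 1"
proof -
  have "c u \<ge> 1" "c v \<ge> 1" "c u \<noteq> c v" "c u \<le> 2" "c v \<le> 2"
    using assms edge_verts[of u v] by (auto simp: proper_def low_edge_def)
  then show ?thesis by linarith
qed

text \<open>\<open>3 - c v\<close> exchanges the colours 1 and 2; \<open>B\<close> will always be a
  union of low edges, where no other colours occur.\<close>

definition swap :: "('a \<Rightarrow> nat) \<Rightarrow> 'a set \<Rightarrow> 'a \<Rightarrow> nat" where
  "swap c B v = (if v \<in> B then 3 - c v else c v)"

context
  fixes c and D
  assumes c: "optimal c" and D: "D \<subseteq> low_edges c"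
begin

lemma swap_partner:
  assumes "u \<in> \<Union>D"
  obtains v where "v \<in> \<Union>D" "low_edge c u v"
proof -
  obtain p q where "{p, q} \<in> D" "low_edge c p q" "u = p \<or> u = q"
    using assms D unfolding low_edges_def by blast
  then show ?thesis using that low_edge_sym by (metis UnionI insertCI)
qed

lemma swap_colour: "v \<in> \<Union>D \<Longrightarrow> c v = 1 \<or> c v = 2"
  using swap_partner[of v] low_edge_colours c unfolding optimal_def by metis

lemma swap_low: "swap c (\<Union>D) v \<le> 2 \<longleftrightarrow> c v \<le> 2"
proof (cases "v \<in> \<Union>D")
  case True
  then show ?thesis using swap_colour[OF True] unfolding swap_def by (elim disjE) simp_all
qed (simp add: swap_def)

lemma low_edge_swap: "low_edge (swap c (\<Union>D)) u v \<longleftrightarrow> low_edge c u v"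
  by (simp add: low_edge_def swap_low)

text \<open>Apart from its partner, an end of a low edge has only neighbours of colour at least 3,
  so swapping creates no conflict; exchanging two colours keeps the sum.\<close>

lemma optimal_swap: "optimal (swap c (\<Union>D))"
proof -
  let ?B = "\<Union>D"
  have pc: "proper c" using c by (simp add: optimal_def)
  have ne: "swap c ?B u \<noteq> swap c ?B v" if uv: "{u, v} \<in> E" "u \<in> ?B" for u v
  proof -
    obtain w where w: "w \<in> ?B" "low_edge c u w" using swap_partner uv(2) .
    show ?thesis
    proof (cases "c v \<le> 2")
      case True
      then have "v = w" using w(2) uv(1) unfolding low_edge_def by blast
      then show ?thesis using w(1) uv(2) low_edge_colours[OF pc w(2)] unfolding swap_def by auto
    next
      case False
      then have "\<not> swap c ?B v \<le> 2" "swap c ?B u \<le> 2"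
        using swap_low w(2) unfolding low_edge_def by blast+
      then show ?thesis by auto
    qed
  qed
  have "swap c ?B u \<noteq> swap c ?B v" if e: "{u, v} \<in> E" for u v
  proof (cases "u \<in> ?B \<or> v \<in> ?B")
    case True
    then show ?thesis using ne[of u v] ne[of v u] e by (metis insert_commute)
  next
    case False
    then show ?thesis using pc e by (auto simp: swap_def proper_def)
  qed
  moreover have "swap c ?B v \<ge> 1" if "v \<in> V" for v
  proof (cases "v \<in> ?B")
    case True
    then show ?thesis using swap_colour[OF True] unfolding swap_def by (elim disjE) simp_all
  next
    case False
    then show ?thesis using pc that unfolding swap_def proper_def by simp
  qed
  ultimately have "proper (swap c ?B)" by (simp add: proper_def)
  moreover have "(\<Sum>v\<in>V. swap c ?B v) = (\<Sum>v\<in>V. c v)"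
  proof -
    have "\<exists>v. v \<in> ?B \<and> low_edge c u v" if "u \<in> ?B" for u using swap_partner[OF that] by metis
    then obtain m where m: "\<And>u. u \<in> ?B \<Longrightarrow> m u \<in> ?B" "\<And>u. u \<in> ?B \<Longrightarrow> low_edge c u (m u)" by metis
    have mm: "m (m u) = u" if "u \<in> ?B" for u
      using low_edge_unique[OF m(2)[OF m(1)[OF that]] low_edge_sym[OF m(2)[OF that]]] .
    have "{u, m u} \<in> E" if "u \<in> ?B" for u using m(2)[OF that] unfolding low_edge_def by blast
    then have BV: "?B \<subseteq> V" using edge_verts by blast
    have "(\<Sum>v\<in>?B. swap c ?B v) = (\<Sum>v\<in>?B. c v)"
    proof (rule sum.reindex_bij_witness[of ?B m m])
      fix u assume u: "u \<in> ?B"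
      show "c (m u) = swap c ?B u"
        using low_edge_colours[OF pc m(2)[OF u]] u by (auto simp: swap_def)
    qed (use m mm in auto)
    moreover have "(\<Sum>v\<in>V - ?B. swap c ?B v) = (\<Sum>v\<in>V - ?B. c v)"
      by (intro sum.cong) (auto simp: swap_def)
    ultimately show ?thesis
      using sum.subset_diff[OF BV finite_V, of c] sum.subset_diff[OF BV finite_V, of "swap c ?B"] by simp
  qed
  ultimately show ?thesis using c by (simp add: optimal_def)
qed

end

text \<open>The mark which \<open>w e\<close> puts on its edge to \<open>z e\<close> will distinguish the two ends of the low edge \<open>e\<close>.\<close>

definition anchored :: "('a \<Rightarrow> nat) \<Rightarrow> ('a set \<Rightarrow> 'a) \<Rightarrow> ('a set \<Rightarrow> 'a) \<Rightarrow> bool" where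
  "anchored c z w \<longleftrightarrow> (\<forall>e \<in> low_edges c. z e \<in> e \<and> {z e, w e} \<in> E \<and> c (w e) \<ge> 3 \<and>
    c (z e) = parity_class (c (w e)))"

text \<open>A low edge is not isolated in the whole graph, so one end has a neighbour of colour at
  least 3. If that end has the wrong one of the colours 1 and 2, swap the edge; low edges are
  disjoint, so these swaps are independent.\<close>

lemma ex_anchored:
  assumes no_isolated_edge: "\<And>u v. {u, v} \<in> E \<Longrightarrow> \<exists>w. {u, w} \<in> E \<and> w \<noteq> v \<or> {v, w} \<in> E \<and> w \<noteq> u"
  shows "\<exists>c z w. optimal c \<and> anchored c z w"
proof -
  obtain c where c: "optimal c" using ex_optimal by blast
  have "\<exists>z w. z \<in> e \<and> {z, w} \<in> E \<and> c w \<ge> 3" if "e \<in> low_edges c" for e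
  proof -
    obtain u v where e: "e = {u, v}" "low_edge c u v" using \<open>e \<in> low_edges c\<close> by (auto simp: low_edges_def)
    then obtain w where "{u, w} \<in> E \<and> w \<noteq> v \<or> {v, w} \<in> E \<and> w \<noteq> u"
      using no_isolated_edge[of u v] unfolding low_edge_def by blast
    moreover from this have "\<not> c w \<le> 2" using e(2) unfolding low_edge_def by blast
    ultimately show ?thesis using e(1) by (intro exI[of _ "if {u, w} \<in> E then u else v"] exI[of _ w]) auto
  qed
  then obtain z w where zw: "\<And>e. e \<in> low_edges c \<Longrightarrow> z e \<in> e"
    "\<And>e. e \<in> low_edges c \<Longrightarrow> {z e, w e} \<in> E" "\<And>e. e \<in> low_edges c \<Longrightarrow> c (w e) \<ge> 3" by metis
  define D where "D = {e \<in> low_edges c. c (z e) \<noteq> parity_class (c (w e))}"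
  have D: "D \<subseteq> low_edges c" by (auto simp: D_def)
  let ?c = "swap c (\<Union>D)"
  have low: "low_edges ?c = low_edges c" by (simp add: low_edges_def low_edge_swap[OF c D])
  have "anchored ?c z w"
    unfolding anchored_def
  proof (intro ballI)
    fix e assume "e \<in> low_edges ?c"
    then have e: "e \<in> low_edges c" using low by simp
    have "w e \<notin> \<Union>D" using swap_colour[OF c D, of "w e"] zw(3)[OF e] by auto
    then have we: "?c (w e) = c (w e)" by (simp add: swap_def)
    obtain u v where uv: "e = {u, v}" "low_edge c u v" using e by (auto simp: low_edges_def)
    have "c (z e) = 1 \<or> c (z e) = 2"
      using low_edge_colours[of c u v] uv zw(1)[OF e] c by (auto simp: optimal_def)
    moreover have "z e \<in> \<Union>D \<longleftrightarrow> e \<in> D"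
      using low_edges_disjoint[OF e _ zw(1)[OF e]] D zw(1)[OF e] by blast
    ultimately have "?c (z e) = parity_class (c (w e))"
      using e by (auto simp: swap_def D_def parity_class_def split: if_splits)
    then show "z e \<in> e \<and> {z e, w e} \<in> E \<and> ?c (w e) \<ge> 3 \<and> ?c (z e) = parity_class (?c (w e))"
      using zw[OF e] we by simp
  qed
  then show ?thesis using optimal_swap[OF c D] by blast
qed

text \<open>If every neighbour of \<open>v\<close> in its parity class were an anchor assigned to \<open>v\<close>, then swapping
  all low edges assigned to \<open>v\<close> would keep the colouring optimal, so \<open>v\<close> is also adjacent to the
  other end of one of them.\<close>

lemma anchored_choice:
  assumes c: "optimal c" and anch: "anchored c z w" and v: "v \<in> V" "c v \<ge> 3"
  obtains Q p\<^sub>s p\<^sub>o where "\<forall>q \<in> Q. {q, v} \<in> E \<and> c q = parity_class (c v)"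
    and "{p\<^sub>s, v} \<in> E" "c p\<^sub>s = parity_class (c v)" "p\<^sub>s \<notin> Q"
    and "{p\<^sub>o, v} \<in> E" "c p\<^sub>o = 3 - parity_class (c v)"
    and "\<forall>e \<in> low_edges c. w e = v \<longrightarrow> e \<inter> insert p\<^sub>o Q \<noteq> {}"
proof -
  let ?k = "parity_class (c v)"
  have k: "?k = 1 \<or> ?k = 2" by (simp add: parity_class_def)
  define D where "D = {e \<in> low_edges c. w e = v}"
  have D: "D \<subseteq> low_edges c" by (auto simp: D_def)
  have zD: "z e \<in> e" "{z e, v} \<in> E" "c (z e) = ?k" if "e \<in> D" for e
    using that anch by (auto simp: anchored_def D_def)
  show ?thesis
  proof (cases "\<exists>p. {p, v} \<in> E \<and> c p = ?k \<and> p \<notin> z ` D")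
    case True
    then obtain p where p: "{p, v} \<in> E" "c p = ?k" "p \<notin> z ` D" by blast
    have "1 \<le> 3 - ?k" "3 - ?k < c v" using k v(2) by auto
    then obtain q where q: "{q, v} \<in> E" "c q = 3 - ?k" using optimal_neighbour[OF c v(1)] by blast
    have hit: "e \<inter> insert q (z ` D) \<noteq> {}" if "e \<in> low_edges c" "w e = v" for e
      using zD(1)[of e] that unfolding D_def by blast
    show ?thesis
    proof (rule that[of "z ` D" p q])
      show "\<forall>y \<in> z ` D. {y, v} \<in> E \<and> c y = ?k" using zD(2,3) by blast
    qed (use p q hit in auto)
  next
    case False
    let ?c = "swap c (\<Union>D)"
    have "v \<notin> \<Union>D" using swap_colour[OF c D, of v] v(2) by auto
    then have "?c v = c v" by (simp add: swap_def)
    then have "1 \<le> ?k" "?k < ?c v" using k v(2) by auto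
    then obtain p where p: "{p, v} \<in> E" "?c p = ?k"
      using optimal_neighbour[OF optimal_swap[OF c D] v(1)] by blast
    have pD: "p \<in> \<Union>D"
    proof (rule ccontr)
      assume "p \<notin> \<Union>D"
      then have "c p = ?k" using p(2) by (simp add: swap_def)
      then have "p \<in> z ` D" using False p(1) by blast
      then show False using zD(1) \<open>p \<notin> \<Union>D\<close> by blast
    qed
    \<comment> \<open>\<open>p\<close> is the other end of the low edge \<open>e\<close>. It meets
      \<open>e\<close> in place of the anchor \<open>z e\<close>, which becomes available as
      \<open>p\<^sub>s\<close>.\<close>
    then obtain e where e: "e \<in> D" "p \<in> e" by blast
    have cp: "c p = 3 - ?k" using swap_colour[OF c D pD] p(2) pD k unfolding swap_def by (elim disjE) auto
    have hit: "e' \<inter> insert p (z ` D - {z e}) \<noteq> {}" if "e' \<in> low_edges c" "w e' = v" for e'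
    proof (cases "e' = e")
      case False
      have e': "e' \<in> D" using that by (simp add: D_def)
      have "z e' \<noteq> z e"
      proof
        assume "z e' = z e"
        then have "z e \<in> e'" using zD(1)[OF e'] by simp
        then show False
          using low_edges_disjoint[of e' c e "z e"] zD(1)[OF e(1)] D e(1) e' False by blast
      qed
      then show ?thesis using e' zD(1)[OF e'] by blast
    qed (use e in blast)
    show ?thesis
    proof (rule that[of "z ` D - {z e}" "z e" p])
      show "\<forall>y \<in> z ` D - {z e}. {y, v} \<in> E \<and> c y = ?k" using zD(2,3) by blast
    qed (use zD[OF e(1)] p(1) cp hit in auto)
  qed
qed

text \<open>\<open>T\<close> is the set of those neighbours \<open>u\<close> of \<open>v\<close> with smaller colour for which \<open>uv\<close> is labelled 2 if
  \<open>c u\<close> is odd and 3 if \<open>c u\<close> is even; the other edges to smaller colours get the label 1. The edges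
  to larger colours contribute \<open>r\<close> further labels, all of them 2 if \<open>c v\<close> is odd and all of them 3
  if \<open>c v\<close> is even. The parity condition separates odd colours from even ones.\<close>

definition good_marks :: "('a \<Rightarrow> nat) \<Rightarrow> ('a set \<Rightarrow> 'a) \<Rightarrow> 'a \<Rightarrow> nat \<Rightarrow> 'a set \<Rightarrow> bool" where
  "good_marks c w v r T \<longleftrightarrow> (\<forall>u \<in> T. {u, v} \<in> E \<and> c u < c v) \<and>
    card {u \<in> T. odd (c u) \<noteq> odd (c v)} = c v div 2 \<and>
    (let s = r + card {u \<in> T. odd (c u) = odd (c v)} in
      s > 0 \<and> (even (c v div 2 + s) \<longleftrightarrow> odd (c v))) \<and>
    (\<forall>e \<in> low_edges c. w e = v \<longrightarrow> e \<inter> T \<noteq> {})"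

lemma card_other_parity_below: "card {j. 1 \<le> j \<and> j < i \<and> odd j \<noteq> odd i} = i div 2"
proof -
  let ?f = "\<lambda>m. if odd i then 2 * m + 2 else 2 * m + 1"
  have "{j. 1 \<le> j \<and> j < i \<and> odd j \<noteq> odd i} = ?f ` {..<i div 2}"
  proof (intro equalityI subsetI)
    fix j assume j: "j \<in> {j. 1 \<le> j \<and> j < i \<and> odd j \<noteq> odd i}"
    then have "j = ?f ((j - 1) div 2)" "(j - 1) div 2 < i div 2" by (auto; presburger)+
    then show "j \<in> ?f ` {..<i div 2}" by blast
  next
    fix j assume "j \<in> ?f ` {..<i div 2}"
    then show "j \<in> {j. 1 \<le> j \<and> j < i \<and> odd j \<noteq> odd i}" by (auto split: if_splits; presburger)
  qed
  moreover have "card (?f ` {..<i div 2}) = card {..<i div 2}"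
    by (rule card_image) (auto simp: inj_on_def)
  ultimately show ?thesis by (simp only: card_lessThan)
qed

text \<open>One neighbour of each smaller colour of the other parity, \<open>p\<^sub>o\<close> among
  them, gives the exact count. In the own parity \<open>Q\<close> is forced by the low edges, and
  \<open>P\<close> adjusts positivity and parity.\<close>

lemma ex_good_marks:
  assumes c: "optimal c" and anch: "anchored c z w" and v: "v \<in> V" "c v \<ge> 3"
  shows "\<exists>T. good_marks c w v r T"
proof -
  let ?i = "c v" and ?h = "c v div 2"
  let ?k = "parity_class ?i"
  have k: "?k = 1 \<or> ?k = 2" "odd ?k = odd ?i" "odd (3 - ?k) \<noteq> odd ?i" by (auto simp: parity_class_def)
  obtain Q p\<^sub>s p\<^sub>o where Q: "\<forall>q \<in> Q. {q, v} \<in> E \<and> c q = ?k"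
    and ps: "{p\<^sub>s, v} \<in> E" "c p\<^sub>s = ?k" "p\<^sub>s \<notin> Q" and po: "{p\<^sub>o, v} \<in> E" "c p\<^sub>o = 3 - ?k"
    and hit: "\<forall>e \<in> low_edges c. w e = v \<longrightarrow> e \<inter> insert p\<^sub>o Q \<noteq> {}"
    using anchored_choice[OF c anch v] .
  define J where "J = {j. 1 \<le> j \<and> j < ?i \<and> odd j \<noteq> odd ?i}"
  have "\<exists>u. {u, v} \<in> E \<and> c u = j \<and> (j = 3 - ?k \<longrightarrow> u = p\<^sub>o)" if "j \<in> J" for j
    using optimal_neighbour[OF c v(1), of j] that po unfolding J_def by (cases "j = 3 - ?k") auto
  then obtain f where f: "\<And>j. j \<in> J \<Longrightarrow> {f j, v} \<in> E \<and> c (f j) = j \<and> (j = 3 - ?k \<longrightarrow> f j = p\<^sub>o)" by metis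
  have "3 - ?k \<in> J" using k v(2) by (auto simp: J_def)
  then have po_in: "p\<^sub>o \<in> f ` J" using f by (metis imageI)
  have "inj_on f J" using f by (metis inj_onI)
  then have card_other: "card (f ` J) = ?h"
    using card_other_parity_below[of ?i, folded J_def] by (simp only: card_image)
  have finE: "finite {u. {u, v} \<in> E}" using finite_V by (rule rev_finite_subset) (use edge_verts in blast)
  have finQ: "finite Q" using finE by (rule rev_finite_subset) (use Q in blast)
  define ext where "ext P \<longleftrightarrow> finite P \<and> P \<inter> Q = {} \<and> (\<forall>u \<in> P. {u, v} \<in> E \<and> c u < ?i \<and> odd (c u) = odd ?i) \<and>
    r + card Q + card P > 0 \<and> (even (?h + (r + card Q + card P)) \<longleftrightarrow> odd ?i)" for P
  have "\<exists>P. ext P"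
  proof -
    let ?s = "r + card Q"
    have psi: "c p\<^sub>s < ?i" using ps(2) k(1) v(2) by auto
    consider "even (?h + ?s) \<longleftrightarrow> odd ?i" "?s > 0" | "\<not> (even (?h + ?s) \<longleftrightarrow> odd ?i)"
      | "even ?h \<longleftrightarrow> odd ?i" "?s = 0" by fastforce
    then show ?thesis
    proof cases
      case 1
      then show ?thesis by (intro exI[of _ "{}"]) (auto simp: ext_def)
    next
      case 2
      then show ?thesis using ps k psi by (intro exI[of _ "{p\<^sub>s}"]) (auto simp: ext_def)
    next
      case 3
      \<comment> \<open>The parity is right but there is no mark yet, so two are added. The colours
        3 and 4 fail the parity condition at \<open>s = 0\<close>; hence \<open>?i \<ge> 5\<close>
        and a second smaller colour of the own parity exists.\<close>
      have "?k + 2 < ?i" using 3(1) v(2) by (auto simp: parity_class_def elim!: oddE evenE)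
      then obtain u where u: "{u, v} \<in> E" "c u = ?k + 2"
        using optimal_neighbour[OF c v(1), of "?k + 2"] by auto
      have "u \<notin> Q" using Q u(2) by auto
      moreover have "u \<noteq> p\<^sub>s" using u ps by auto
      ultimately show ?thesis using ps k psi u \<open>?k + 2 < ?i\<close> 3 by (intro exI[of _ "{p\<^sub>s, u}"]) (auto simp: ext_def)
    qed
  qed
  then obtain P where ext: "ext P" ..
  then have P: "finite P" "P \<inter> Q = {}" "r + card Q + card P > 0"
      "even (?h + (r + card Q + card P)) \<longleftrightarrow> odd ?i"
    and P_edge: "\<And>u. u \<in> P \<Longrightarrow> {u, v} \<in> E \<and> c u < ?i \<and> odd (c u) = odd ?i"
    unfolding ext_def by simp_all
  let ?T = "f ` J \<union> Q \<union> P"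
  have fJ: "odd (c u) \<noteq> odd ?i \<and> {u, v} \<in> E \<and> c u < ?i" if "u \<in> f ` J" for u
    using that f by (auto simp: J_def)
  have QP: "odd (c u) = odd ?i \<and> {u, v} \<in> E \<and> c u < ?i" if "u \<in> Q \<union> P" for u
    using that Q P_edge[of u] k v(2) by auto
  have "{u \<in> ?T. odd (c u) \<noteq> odd ?i} = f ` J" using fJ QP by blast
  moreover have "{u \<in> ?T. odd (c u) = odd ?i} = Q \<union> P" using fJ QP by blast
  moreover have "card (Q \<union> P) = card Q + card P" using finQ P(1,2) by (intro card_Un_disjoint) auto
  moreover have "e \<inter> ?T \<noteq> {}" if "e \<in> low_edges c" "w e = v" for e using hit that po_in by blast
  moreover have "\<forall>u \<in> ?T. {u, v} \<in> E \<and> c u < ?i" using fJ QP by blast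
  ultimately have "good_marks c w v r ?T"
    unfolding good_marks_def Let_def using card_other P(3,4) by (simp add: add.assoc)
  then show ?thesis by blast
qed

text \<open>Well-founded recursion from the largest colour downwards: the marks arriving at
  \<open>v\<close> come from larger colours and are fixed before \<open>S v\<close> is
  chosen.\<close>

lemma ex_marking:
  assumes c: "optimal c" and anch: "anchored c z w"
  obtains S where "\<And>v. v \<in> V \<Longrightarrow> c v \<ge> 3 \<Longrightarrow> good_marks c w v (card {u. v \<in> S u}) (S v)"
    and "\<And>v. \<not> (v \<in> V \<and> c v \<ge> 3) \<Longrightarrow> S v = {}"
    and "\<And>u v. u \<in> S v \<Longrightarrow> {u, v} \<in> E \<and> c u < c v"
proof -
  define m where "m = Max (c ` V)"
  define rel where "rel = measure (\<lambda>v. m - c v)"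
  \<comment> \<open>The count is restricted to larger colours so that \<open>P\<close> depends only
    on \<open>rel\<close>-predecessors; the restriction turns out to be automatic.\<close>
  define P where "P S v T \<longleftrightarrow> (if v \<in> V \<and> c v \<ge> 3
    then good_marks c w v (card {u \<in> V. c v < c u \<and> v \<in> S u}) T else T = {})" for S v T
  have rel: "(u, v) \<in> rel" if "u \<in> V" "c v < c u" for u v
  proof -
    have "c u \<le> m" using that finite_V by (simp add: m_def)
    then show ?thesis using that by (simp add: rel_def)
  qed
  have "\<exists>S. \<forall>v. P S v (S v)"
  proof (rule dependent_wf_choice[of rel P])
    show "wf rel" by (simp add: rel_def)
  next
    fix S S' :: "'a \<Rightarrow> 'a set" and v T assume "\<And>u. (u, v) \<in> rel \<Longrightarrow> S u = S' u"
    then have "{u \<in> V. c v < c u \<and> v \<in> S u} = {u \<in> V. c v < c u \<and> v \<in> S' u}" using rel by blast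
    then show "P S v T = P S' v T" by (simp add: P_def)
  next
    fix v S
    show "\<exists>T. P S v T" using ex_good_marks[OF c anch] by (auto simp: P_def)
  qed
  then obtain S where S: "\<And>v. P S v (S v)" by blast
  have S_empty: "S v = {}" if "\<not> (v \<in> V \<and> c v \<ge> 3)" for v using S[of v] that by (simp add: P_def)
  have S_good: "good_marks c w v (card {u \<in> V. c v < c u \<and> v \<in> S u}) (S v)" if "v \<in> V" "c v \<ge> 3" for v
    using S[of v] that by (simp add: P_def)
  have S_edge: "{u, v} \<in> E \<and> c u < c v" if "u \<in> S v" for u v
    using S_empty[of v] S_good[of v] that by (auto simp: good_marks_def)
  have "{u \<in> V. c v < c u \<and> v \<in> S u} = {u. v \<in> S u}" for v using S_edge edge_verts by blast
  then show ?thesis using that[of S] S_good S_empty S_edge by simp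
qed

text \<open>The smaller end of an edge decides whether it counts. On edges from above this end is
  \<open>x\<close> itself, so they count all or not at all.\<close>

lemma edge_degree_marked:
  assumes S: "\<And>u v. u \<in> S v \<Longrightarrow> {u, v} \<in> E \<and> c u < (c v :: nat)"
  shows "edge_degree {{u, v} | u v. u \<in> S v \<and> R (c u)} x =
    card {u \<in> S x. R (c u)} + (if R (c x) then card {v. x \<in> S v} else 0)"
proof -
  let ?A = "(\<lambda>u. {u, x}) ` {u \<in> S x. R (c u)}"
  let ?B = "if R (c x) then (\<lambda>v. {x, v}) ` {v. x \<in> S v} else {}"
  have "{e \<in> {{u, v} | u v. u \<in> S v \<and> R (c u)}. x \<in> e} = ?A \<union> ?B" by auto
  moreover have "?A \<inter> ?B = {}"
  proof -
    have "{u, x} \<noteq> {x, v}" if "u \<in> S x" "x \<in> S v" for u v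
      using S[OF that(1)] S[OF that(2)] by (auto simp: doubleton_eq_iff)
    then show ?thesis by auto
  qed
  moreover have "finite {u \<in> S x. R (c u)}" "finite {v. x \<in> S v}"
    using finite_subset[OF _ finite_V] S edge_verts by (metis (no_types, lifting) mem_Collect_eq subsetI)+
  moreover have "inj_on (\<lambda>u. {u, x}) U" "inj_on (\<lambda>v. {x, v}) U" for U
    by (auto simp: inj_on_def doubleton_eq_iff)
  ultimately show ?thesis
    unfolding edge_degree_def by (simp add: card_Un_disjoint card_image)
qed

section \<open>The labelling\<close>

text \<open>The marks settle the colours from 3 on; their contributions to colours 1 and 2 become
  the weights of the bipartite graph \<open>E\<^sub>0\<close>, whose separating sets are added to
  them.\<close>

lemma separated_pairs_exist:
  assumes no_isolated_edge: "\<And>u v. {u, v} \<in> E \<Longrightarrow> \<exists>w. {u, w} \<in> E \<and> w \<noteq> v \<or> {v, w} \<in> E \<and> w \<noteq> u"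
  shows "\<exists>T\<^sub>2 T\<^sub>3. T\<^sub>2 \<inter> T\<^sub>3 = {} \<and> T\<^sub>2 \<subseteq> E \<and> T\<^sub>3 \<subseteq> E \<and> (\<forall>u v. {u, v} \<in> E \<longrightarrow>
    (edge_degree T\<^sub>2 u, edge_degree T\<^sub>3 u) \<noteq> (edge_degree T\<^sub>2 v, edge_degree T\<^sub>3 v))"
proof -
  obtain c z w where c: "optimal c" and anch: "anchored c z w"
    using ex_anchored[OF no_isolated_edge] by blast
  have pc: "proper c" using c by (simp add: optimal_def)
  obtain S where good: "\<And>v. v \<in> V \<Longrightarrow> c v \<ge> 3 \<Longrightarrow> good_marks c w v (card {u. v \<in> S u}) (S v)"
    and S_empty: "\<And>v. \<not> (v \<in> V \<and> c v \<ge> 3) \<Longrightarrow> S v = {}"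
    and S_edge: "\<And>u v. u \<in> S v \<Longrightarrow> {u, v} \<in> E \<and> c u < c v"
    using ex_marking[OF c anch] by blast
  define P\<^sub>2 where "P\<^sub>2 = {{u, v} | u v. u \<in> S v \<and> odd (c u)}"
  define P\<^sub>3 where "P\<^sub>3 = {{u, v} | u v. u \<in> S v \<and> even (c u)}"
  have P_E: "P\<^sub>2 \<subseteq> E" "P\<^sub>3 \<subseteq> E" using S_edge by (auto simp: P\<^sub>2_def P\<^sub>3_def)
  let ?a = "edge_degree P\<^sub>2" and ?b = "edge_degree P\<^sub>3"
  have a: "?a v = card {u \<in> S v. odd (c u)} + (if odd (c v) then card {u. v \<in> S u} else 0)" for v
    unfolding P\<^sub>2_def by (rule edge_degree_marked) (rule S_edge)
  have b: "?b v = card {u \<in> S v. even (c u)} + (if even (c v) then card {u. v \<in> S u} else 0)" for v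
    unfolding P\<^sub>3_def by (rule edge_degree_marked) (rule S_edge)
  define X where "X = {v \<in> V. c v = 1}"
  define Y where "Y = {v \<in> V. c v = 2}"
  define E\<^sub>0 where "E\<^sub>0 = {e \<in> E. e \<subseteq> X \<union> Y}"
  have XY: "v \<in> X \<union> Y \<longleftrightarrow> v \<in> V \<and> \<not> c v \<ge> 3" for v
  proof -
    have "c v \<ge> 1" if "v \<in> V" using that pc by (simp add: proper_def)
    then show ?thesis unfolding X_def Y_def by fastforce
  qed
  have S_XY: "S v = {}" if "v \<in> X \<union> Y" for v using that XY S_empty by blast
  interpret B: weighted_bipartite X Y E\<^sub>0 ?a ?b
  proof unfold_locales
    show "finite X" "finite Y" "X \<inter> Y = {}" using finite_V by (auto simp: X_def Y_def)
    show "?a y = 0" if "y \<in> Y" for y using that S_XY[of y] by (simp add: a Y_def)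
    show "?b x = 0" if "x \<in> X" for x using that S_XY[of x] by (simp add: b X_def)
    show "\<exists>x \<in> X. \<exists>y \<in> Y. e = {x, y}" if "e \<in> E\<^sub>0" for e
    proof -
      obtain u v where uv: "e = {u, v}" "{u, v} \<in> E" "u \<in> X \<union> Y" "v \<in> X \<union> Y"
        using \<open>e \<in> E\<^sub>0\<close> edgeE[of e] by (auto simp: E\<^sub>0_def)
      then have "c u \<noteq> c v" using pc by (simp add: proper_def)
      then consider "u \<in> X" "v \<in> Y" | "u \<in> Y" "v \<in> X" using uv(3,4) by (auto simp: X_def Y_def)
      then show ?thesis using uv(1) by (metis insert_commute)
    qed
  qed
  have "\<exists>S\<^sub>2 S\<^sub>3. B.separating S\<^sub>2 S\<^sub>3"
  proof (rule B.separating_all_components)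
    fix x y assume xy: "{x, y} \<in> E\<^sub>0" "x \<in> X" "y \<in> Y"
      and iso: "\<And>v. {x, v} \<in> E\<^sub>0 \<Longrightarrow> v = y" "\<And>u. {u, y} \<in> E\<^sub>0 \<Longrightarrow> u = x"
    have low: "{p, q} \<in> E\<^sub>0" if "{p, q} \<in> E" "c p \<le> 2" "c q \<le> 2" for p q
      using that edge_verts[OF that(1)] XY[of p] XY[of q] by (simp add: E\<^sub>0_def)
    have cxy: "c x \<le> 2" "c y \<le> 2" using xy by (auto simp: X_def Y_def)
    have "v = y" if "{x, v} \<in> E" "c v \<le> 2" for v using iso(1) low that cxy by blast
    moreover have "u = x" if "{y, u} \<in> E" "c u \<le> 2" for u
      using iso(2)[of u] low[of u y] that cxy by (simp add: insert_commute)
    ultimately have "low_edge c x y" using xy(1) cxy by (simp add: low_edge_def E\<^sub>0_def)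
    then have e: "{x, y} \<in> low_edges c" by (auto simp: low_edges_def)
    define v where "v = w {x, y}"
    have v: "v \<in> V" "c v \<ge> 3"
      using anch e edge_verts[of "z {x, y}" v] unfolding anchored_def v_def by blast+
    \<comment> \<open>The vertex assigned to this low edge marks one of its ends, with a 2 at
      \<open>x\<close> or a 3 at \<open>y\<close>.\<close>
    have "{x, y} \<inter> S v \<noteq> {}" using good[OF v] e unfolding good_marks_def v_def by blast
    then have "x \<in> S v \<or> y \<in> S v" by blast
    moreover have "finite P\<^sub>2" "finite P\<^sub>3" using P_E finite_subset[OF _ finite_E] by blast+
    moreover have "{x, v} \<in> P\<^sub>2" if "x \<in> S v"
      unfolding P\<^sub>2_def using that xy by (intro CollectI exI[of _ x] exI[of _ v]) (simp add: X_def)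
    moreover have "{y, v} \<in> P\<^sub>3" if "y \<in> S v"
      unfolding P\<^sub>3_def using that xy by (intro CollectI exI[of _ y] exI[of _ v]) (simp add: Y_def)
    ultimately show "?a x \<noteq> 0 \<or> ?b y \<noteq> 0"
      using edge_degree_ge_1[of P\<^sub>2 "{x, v}" x] edge_degree_ge_1[of P\<^sub>3 "{y, v}" y] by auto
  qed
  then obtain S\<^sub>2 S\<^sub>3 where sep: "B.separating S\<^sub>2 S\<^sub>3" by blast
  have S23: "S\<^sub>2 \<subseteq> E\<^sub>0" "S\<^sub>3 \<subseteq> E\<^sub>0" "S\<^sub>2 \<inter> S\<^sub>3 = {}" using sep unfolding B.separating_def by blast+
  have P_E0: "(P\<^sub>2 \<union> P\<^sub>3) \<inter> E\<^sub>0 = {}"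
  proof -
    have "e \<notin> E\<^sub>0" if "e \<in> P\<^sub>2 \<union> P\<^sub>3" for e
    proof -
      obtain u v where "e = {u, v}" "u \<in> S v" using \<open>e \<in> P\<^sub>2 \<union> P\<^sub>3\<close> by (auto simp: P\<^sub>2_def P\<^sub>3_def)
      then show ?thesis using S_XY[of v] by (auto simp: E\<^sub>0_def)
    qed
    then show ?thesis by blast
  qed
  have P23: "P\<^sub>2 \<inter> P\<^sub>3 = {}"
  proof -
    have "{u, v} \<noteq> {u', v'}" if "u \<in> S v" "u' \<in> S v'" "odd (c u)" "even (c u')" for u v u' v'
      using S_edge[OF that(1)] S_edge[OF that(2)] that(3,4) by (auto simp: doubleton_eq_iff)
    then show ?thesis unfolding P\<^sub>2_def P\<^sub>3_def by blast
  qed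
  have "E\<^sub>0 \<subseteq> E" by (auto simp: E\<^sub>0_def)
  then have S_E: "S\<^sub>2 \<subseteq> E" "S\<^sub>3 \<subseteq> E" using S23(1,2) by blast+
  have fin: "finite P\<^sub>2" "finite P\<^sub>3" "finite S\<^sub>2" "finite S\<^sub>3"
    using P_E S_E finite_subset[OF _ finite_E] by blast+
  have d2: "edge_degree (P\<^sub>2 \<union> S\<^sub>2) v = ?a v + edge_degree S\<^sub>2 v" for v
    using fin P_E0 S23 by (intro edge_degree_Un) auto
  have d3: "edge_degree (P\<^sub>3 \<union> S\<^sub>3) v = ?b v + edge_degree S\<^sub>3 v" for v
    using fin P_E0 S23 by (intro edge_degree_Un) auto
  define p where "p v = edge_degree (P\<^sub>2 \<union> S\<^sub>2) v" for v
  define q where "q v = edge_degree (P\<^sub>3 \<union> S\<^sub>3) v" for v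
  have low: "admissible (p v) (q v)" if "v \<in> V" "c v < 3" for v
    using that sep XY[of v] unfolding B.separating_def p_def q_def d2 d3 by auto
  have level: "(p x, q x) \<noteq> (p y, q y)" if "x \<in> X" "y \<in> Y" "{x, y} \<in> E\<^sub>0" for x y
    using that sep unfolding B.separating_def p_def q_def d2 d3 by blast
  have high: "p v > 0 \<and> q v > 0 \<and> (if odd (c v) then q v = c v div 2 else p v = c v div 2) \<and>
      (even (p v + q v) \<longleftrightarrow> odd (c v))" if v: "v \<in> V" "c v \<ge> 3" for v
  proof -
    have "v \<notin> X \<union> Y" using XY v by blast
    then have "edge_degree S\<^sub>2 v = 0" "edge_degree S\<^sub>3 v = 0"
      using S23(1,2) unfolding E\<^sub>0_def by (intro edge_degree_eq_0; blast)+
    then have "p v = ?a v" "q v = ?b v" by (simp_all add: p_def q_def d2 d3)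
    moreover have "c v div 2 > 0" using v(2) by simp
    ultimately show ?thesis
      using good[OF v] unfolding good_marks_def Let_def a b
      by (cases "odd (c v)") (simp_all add: add.commute)
  qed
  have mixed: "(p u, q u) \<noteq> (p v, q v)" if "u \<in> V" "v \<in> V" "c u < 3" "c v \<ge> 3" for u v
  proof
    assume eq: "(p u, q u) = (p v, q v)"
    \<comment> \<open>Both counts are positive at \<open>v\<close>, which leaves only the third form
      of an admissible pair. Its odd sum makes \<open>c v\<close> even, so \<open>p v\<close> is
      \<open>c v div 2\<close> and \<open>c v\<close> would be 2.\<close>
    then have "p v = 1" "even (q v)"
      using low[OF that(1,3)] high[OF that(2,4)] by (auto simp: admissible_def)
    then have "even (c v)" "c v div 2 = 1" using high[OF that(2,4)] by (auto split: if_splits)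
    then show False using that(4) by (auto elim!: evenE)
  qed
  have main: "(p u, q u) \<noteq> (p v, q v)" if e: "{u, v} \<in> E" for u v
  proof -
    have uv: "u \<in> V" "v \<in> V" "c u \<noteq> c v" using e edge_verts pc by (auto simp: proper_def)
    consider "c u < 3" "c v < 3" | "c u < 3" "c v \<ge> 3" | "c u \<ge> 3" "c v < 3" | "c u \<ge> 3" "c v \<ge> 3"
      by linarith
    then show ?thesis
    proof cases
      case 1
      then have "{u, v} \<in> E\<^sub>0" using e uv XY[of u] XY[of v] by (simp add: E\<^sub>0_def)
      moreover from this have "{v, u} \<in> E\<^sub>0" by (simp only: insert_commute)
      ultimately show ?thesis using B.edge_cases[of u v] level[of u v] level[of v u] by metis
    next
      case 2
      then show ?thesis using mixed uv by blast
    next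
      case 3
      then show ?thesis using mixed[of v u] uv by metis
    next
      case 4
      show ?thesis
      proof
        assume "(p u, q u) = (p v, q v)"
        \<comment> \<open>The parity of the sum reveals the parity of the colour, which tells which
          of the two counts is half the colour.\<close>
        then have "odd (c u) \<longleftrightarrow> odd (c v)" "c u div 2 = c v div 2"
          using high[OF uv(1) 4(1)] high[OF uv(2) 4(2)] by (auto split: if_splits)
        then have "c u = c v" by presburger
        then show False using uv(3) by simp
      qed
    qed
  qed
  have "(P\<^sub>2 \<union> S\<^sub>2) \<inter> (P\<^sub>3 \<union> S\<^sub>3) = {}" using P23 P_E0 S23 by blast
  moreover have "P\<^sub>2 \<union> S\<^sub>2 \<subseteq> E" "P\<^sub>3 \<union> S\<^sub>3 \<subseteq> E" using P_E S_E by blast+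
  ultimately show ?thesis using main unfolding p_def q_def by metis
qed

end

section \<open>Translation to digraphs and products of labels\<close>

lemma (in graph) mem_edges_iff: "{u, v} \<in> edges G \<longleftrightarrow> u \<rightarrow>\<^bsub>G\<^esub> v"
proof
  assume "{u, v} \<in> edges G"
  then obtain x y where "{u, v} = {x, y}" "x \<rightarrow>\<^bsub>G\<^esub> y" unfolding edges_def by blast
  then show "u \<rightarrow>\<^bsub>G\<^esub> v" using graph_symmetric[of x y] by (auto simp: doubleton_eq_iff)
qed (auto simp: edges_def)

text \<open>For maximality: in a connected subgraph containing \<open>u\<close>, no walk from
  \<open>u\<close> leaves \<open>{u, v}\<close>, and the induced subgraph already has all arcs on
  these two vertices.\<close>

lemma (in graph) isolated_edge_component:
  assumes uv: "{u, v} \<in> edges G"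
    and u: "\<And>w. {u, w} \<in> edges G \<Longrightarrow> w = v" and v: "\<And>w. {v, w} \<in> edges G \<Longrightarrow> w = u"
  shows "graph_component G (G \<restriction> {u, v}) \<and> complete_digraph 2 (G \<restriction> {u, v})"
proof -
  let ?H = "G \<restriction> {u, v}"
  have arc: "u \<rightarrow>\<^bsub>G\<^esub> v" "v \<rightarrow>\<^bsub>G\<^esub> u" using uv mem_edges_iff by (metis insert_commute)+
  then have ne: "u \<noteq> v" using adj_not_same by blast
  have verts: "{u, v} \<subseteq> verts G" using arc adj_in_verts by blast
  have sub: "subgraph ?H G" using verts by (rule subgraph_induce_subgraphI)
  have ind: "induced_subgraph ?H G" using verts by (rule induced_induce)
  interpret H: graph ?H
    using induced_graph_imp_graph[OF ind] digraphI_induced[OF ind]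
    by (simp add: graph_def pseudo_graph_def digraph_def)
  have ends: "arcs_ends ?H = {(u, v), (v, u)}"
  proof -
    have "(x, y) \<in> arcs_ends ?H \<longleftrightarrow> (x, y) \<in> arcs_ends G \<and> x \<in> {u, v} \<and> y \<in> {u, v}" for x y
      by (auto simp: arcs_ends_conv)
    then show ?thesis using arc adj_not_same by auto
  qed
  have complete: "complete_digraph 2 ?H"
    unfolding complete_digraph_def using H.graph_axioms ends ne by auto
  have "strongly_connected ?H"
    using ends by (intro strongly_connectedI) (auto intro: H.reachable_adjI)
  then have conn: "connected ?H"
    unfolding connected_def using H.reachable_mk_symmetricI by (auto simp: strongly_connected_def)
  have "max_subgraph connected ?H"
  proof (rule max_subgraphI[where P = connected, OF conn sub])
    fix H' assume H': "?H \<noteq> H'" "subgraph ?H H'" "subgraph H' G"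
    show "\<not> connected H'"
    proof
      assume connected: "connected H'"
      interpret H': wf_digraph H' using H'(3) by (simp add: subgraph_def)
      have "verts H' \<subseteq> {u, v}"
      proof
        fix x assume "x \<in> verts H'"
        moreover have "u \<in> verts H'" using H'(2) by (auto simp: subgraph_def)
        ultimately have "u \<rightarrow>\<^sup>*\<^bsub>with_proj (mk_symmetric H')\<^esub> x"
          using connected by (auto simp: connected_def strongly_connected_def)
        then have "(u, x) \<in> (parcs (mk_symmetric H'))\<^sup>*"
          by (auto simp: reachable_def dest: rtrancl_on_rtranclI)
        then show "x \<in> {u, v}"
        proof (induction rule: rtrancl_induct)
          case (step y y')
          then obtain e where e: "e \<in> arcs H'"
            "(y, y') = (tail H' e, head H' e) \<or> (y, y') = (head H' e, tail H' e)"
            by (auto simp: parcs_mk_symmetric)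
          then have "e \<in> arcs G" "tail H' e = tail G e" "head H' e = head G e"
            using H'(3) by (auto simp: subgraph_def compatible_def)
          moreover from this have "{tail G e, head G e} \<in> edges G"
            by (simp add: mem_edges_iff in_arcs_imp_in_arcs_ends)
          moreover have "{y, y'} = {tail H' e, head H' e}" using e(2) by auto
          ultimately have "{y, y'} \<in> edges G" by simp
          then show ?case using step.IH u v by blast
        qed simp
      qed
      then have eq: "verts H' = {u, v}" using H'(2) by (auto simp: subgraph_def)
      then have "subgraph H' ?H" using subgraph_induce_subgraphI2[OF H'(3)] by simp
      then have "?H = H'"
        using H'(2) eq by (intro pre_digraph.equality) (auto simp: subgraph_def compatible_def)
      then show False using H'(1) by simp
    qed
  qed
  then show ?thesis using complete by (simp add: graph_component_def)
qed

text \<open>Unique factorization by induction on \<open>a\<close>: the parity of the product shows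
  whether a factor 2 can be cancelled on both sides.\<close>

lemma power_2_3_cancel:
  fixes a b c d :: nat
  assumes "2 ^ a * 3 ^ b = (2 ^ c * 3 ^ d :: nat)"
  shows "a = c \<and> b = d"
  using assms
proof (induction a arbitrary: c)
  case 0
  then have "odd (2 ^ c * 3 ^ d :: nat)" by (metis even_power mult_1 odd_numeral power_0)
  then have "c = 0" by simp
  then show ?case using 0 by simp
next
  case (Suc a)
  then have "even (2 ^ c * 3 ^ d :: nat)" by (metis even_mult_iff even_power dvd_refl zero_less_Suc)
  then obtain c' where "c = Suc c'" by (cases c) auto
  then show ?case using Suc by simp
qed

lemma prod_labels_eq:
  assumes "finite E" "T\<^sub>2 \<subseteq> E" "T\<^sub>3 \<subseteq> E" "T\<^sub>2 \<inter> T\<^sub>3 = {}"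
  shows "(\<Prod>e \<in> {e \<in> E. v \<in> e}. if e \<in> T\<^sub>2 then 2 else if e \<in> T\<^sub>3 then 3 else 1) =
    2 ^ edge_degree T\<^sub>2 v * (3 ^ edge_degree T\<^sub>3 v :: nat)"
proof -
  let ?E = "{e \<in> E. v \<in> e}"
  have "(\<Prod>e \<in> ?E. if e \<in> T\<^sub>2 then 2 else if e \<in> T\<^sub>3 then 3 else 1 :: nat) =
    (\<Prod>e \<in> ?E. (if e \<in> T\<^sub>2 then 2 else 1) * (if e \<in> T\<^sub>3 then 3 else 1))"
    using assms(4) by (intro prod.cong) auto
  also have "\<dots> = (\<Prod>e \<in> ?E. if e \<in> T\<^sub>2 then 2 else 1) * (\<Prod>e \<in> ?E. if e \<in> T\<^sub>3 then 3 else 1)"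
    by (rule prod.distrib)
  also have "(\<Prod>e \<in> ?E. if e \<in> T\<^sub>2 then 2 else 1 :: nat) = (\<Prod>e \<in> {e \<in> T\<^sub>2. v \<in> e}. 2)"
    using assms(1,2) by (intro prod.mono_neutral_cong_right) auto
  also have "(\<Prod>e \<in> ?E. if e \<in> T\<^sub>3 then 3 else 1 :: nat) = (\<Prod>e \<in> {e \<in> T\<^sub>3. v \<in> e}. 3)"
    using assms(1,3) by (intro prod.mono_neutral_cong_right) auto
  finally show ?thesis by (simp add: edge_degree_def)
qed

theorem theorem1p1:
  fixes G :: "('a, 'b) pre_digraph"
  assumes "graph G"
    and "nice G"
  shows "\<exists>l. labelling 3 G l \<and> p_proper G l"
proof -
  interpret graph G by fact
  interpret S: finite_simple_graph "verts G" "edges G"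
  proof
    fix e assume "e \<in> edges G"
    then obtain u v where "u \<rightarrow>\<^bsub>G\<^esub> v" "e = {u, v}" unfolding edges_def by blast
    then show "\<exists>u \<in> verts G. \<exists>v \<in> verts G. u \<noteq> v \<and> e = {u, v}"
      using adj_not_same adj_in_verts by metis
  qed simp
  have "\<exists>w. {u, w} \<in> edges G \<and> w \<noteq> v \<or> {v, w} \<in> edges G \<and> w \<noteq> u" if "{u, v} \<in> edges G" for u v
    using isolated_edge_component[OF that] assms(2) unfolding nice_def by blast
  then have "\<exists>T\<^sub>2 T\<^sub>3. T\<^sub>2 \<inter> T\<^sub>3 = {} \<and> T\<^sub>2 \<subseteq> edges G \<and> T\<^sub>3 \<subseteq> edges G \<and> (\<forall>u v. {u, v} \<in> edges G \<longrightarrow>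
      (edge_degree T\<^sub>2 u, edge_degree T\<^sub>3 u) \<noteq> (edge_degree T\<^sub>2 v, edge_degree T\<^sub>3 v))"
    by (rule S.separated_pairs_exist)
  then obtain T\<^sub>2 T\<^sub>3 where T: "T\<^sub>2 \<inter> T\<^sub>3 = {}" "T\<^sub>2 \<subseteq> edges G" "T\<^sub>3 \<subseteq> edges G"
    and sep: "\<forall>u v. {u, v} \<in> edges G \<longrightarrow>
      (edge_degree T\<^sub>2 u, edge_degree T\<^sub>3 u) \<noteq> (edge_degree T\<^sub>2 v, edge_degree T\<^sub>3 v)"
    by (elim exE conjE)
  define l where "l e = (if e \<in> T\<^sub>2 then 2 else if e \<in> T\<^sub>3 then 3 else 1 :: nat)" for e
  have "vertex_prod G l v = 2 ^ edge_degree T\<^sub>2 v * 3 ^ edge_degree T\<^sub>3 v" for v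
    unfolding vertex_prod_incident_edges l_def
    using S.finite_E T(2,3,1) by (rule prod_labels_eq)
  then have "p_proper G l" unfolding p_proper_def using sep power_2_3_cancel by metis
  moreover have "labelling 3 G l" by (auto simp: labelling_def l_def)
  ultimately show ?thesis by blast
qed

end
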